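(* Let $T_c>0$, $\alpha>0$, $t_0\ge 0$ and $M$ be given constants, and let $L$ be a known positive function such that $\frac{1}{L(t-t_0)}\left|\frac{dL(t-t_0)}{dt}\right|\le M$ for all $t\ge t_0$. Let $\mathcal{Y}$ be the set of admissible signals, i.e. of differentiable signals $y(t)\in\mathbb{R}$ such that $\dot y$ is Lipschitz and $|\ddot y(t)|\le L(t-t_0)$ for all $t\ge t_0$. Let - $\varphi:[t_0,t_0+T_c)\to[0,+\infty)$ be the bijection $\varphi(t)=-\alpha^{-1}\ln\left(1-(t-t_0)/T_c\right)$, - $\kappa(t-t_0)=\left(\alpha(T_c-(t-t_0))\right)^{-1}$ for $t\in[t_0,t_0+T_c)$, - $\mathcal{L}:[0,+\infty)\to\mathbb{R}$ be the function such that $\mathcal{L}(\varphi(t))=L(t-t_0)\,\kappa(t-t_0)^{-2}$ for $t\in[t_0,t_0+T_c)$, and - $\mathcal{M}$ be a constant such that $\frac{1}{\mathcal{L}(\tau)}\left|\frac{d\mathcal{L}(\tau)}{d\tau}\right|\le\mathcal{M}$ for all $\tau\ge 0$. With $\phi_1,\phi_2$ the functions given in the context, define $$h_1(w,t;T_c)=\begin{cases}\kappa(t-t_0)\left(-\alpha w+\phi_1(w;\mathcal{M},\mathcal{L}(\varphi(t)))\right) & \text{for } t\in[t_0,t_0+T_c),\\ \phi_1(w;M,L(t-t_0)) & \text{otherwise,}\end{cases}$$ $$h_2(w,t;T_c)=\begin{cases}\kappa(t-t_0)^2\left(\alpha^2 w+\phi_2(w;\mathcal{M},\mathcal{L}(\varphi(t)))-\alpha\,\phi_1(w;\mathcal{M},\mathcal{L}(\varphi(t)))\right)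 & \text{for } t\in[t_0,t_0+T_c),\\ \phi_2(w;M,L(t-t_0)) & \text{otherwise.}\end{cases}$$ Then the algorithm $$w=z_0-y(t),\qquad \dot z_0=-h_1(w,t;T_c)+z_1,\qquad \dot z_1=-h_2(w,t;T_c)$$ is a predefined-time first-order exact differentiator with $T_c$ as upper bound for the convergence time: for every $y\in\mathcal{Y}$ and every initial condition $z_0(t_0),z_1(t_0)\in\mathbb{R}$, one has $z_0(t)=y(t)$ and $z_1(t)=\dot y(t)$ for all $t\ge t_0+T_c$. Moreover, if $L(t-t_0)$ is such that the settling-time function of the system $$\dot e_1=-\phi_1(e_1;M,L(t-t_0))+e_2,\qquad \dot e_2=-\phi_2(e_1;M,L(t-t_0))-\ddot y(t)$$ is an unbounded function of the initial condition, then $T_c$ is the least upper bound of the settling time (least UBST) of the differentiation error system $$\dot e_1=-h_1(e_1,t;T_c)+e_2,\qquad \dot e_2=-h_2(e_1,t;T_c)-\ddot y(t).$$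
   Context: **Notation.** $\mathbb{R}_+=\{x\in\mathbb{R}: x\ge 0\}$. For $x\in\mathbb{R}$, $\lfloor x\rceil^{a}=|x|^{a}\,\mathrm{sign}(x)$ if $a\ne 0$, and $\lfloor x\rceil^{0}=\mathrm{sign}(x)$. For $\kappa$, the exponents $-1,-2$ denote reciprocals (not inverse functions). **The functions $\phi_1,\phi_2$.** For constants $M$ and positive values $L$, $$\phi_1(w;M,L)=\lambda_1L^{1/2}\lfloor w\rceil^{1/2}+\mu_1Mw,$$ $$\phi_2(w;M,L)=\lambda_0L\,\mathrm{sign}(w)+\lambda_1\mu_0L^{1/2}M\lfloor w\rceil^{1/2}+\mu_0\mu_1M^2w.$$ Here $\mu_0,\mu_1$ are such that $s^2+\mu_1s+\mu_0\mu_1$ is a Hurwitz polynomial, and $\lambda_0,\lambda_1$ are suitable positive constants; throughout, $\lambda_0=1.1$, $\lambda_1=1.5$, $\mu_0=2$, $\mu_1=3$, the values suggested by Levant and Livne. "Suitable" refers to the known theorem of Levant and Livne: for a function $L(t-t_0)$ and constant $M$ with $\frac{1}{L(t-t_0)}\left|\frac{dL(t-t_0)}{dt}\right|\le M$, and $y$ with $\dot y$ Lipschitz and $|\ddot y(t)|\le L(t-t_0)$ for all $t\ge t_0$, the system $\dot e_1=-\phi_1(e_1;M,L(t-t_0))+e_2$, $\dot e_2=-\phi_2(e_1;M,L(t-t_0))-\ddot y(t)$ is finite-time stable (the origin is globally asymptotically stable and the settling-time function $T(e_0,t_0)$, whose definition is given in this context under "Settling time", is finite for every initial state and initial time). **Solutions.**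 Solutions of all differential equations with discontinuous right-hand side are understood in the sense of Filippov. The differentiation error variables are $e_1=z_0-y(t)$ and $e_2=z_1-\dot y(t)$. Standing assumption on error systems $\dot e_1=-h_1(e_1,t;T_c)+e_2$, $\dot e_2=-h_2(e_1,t;T_c)-\ddot y(t)$: the $h_i$ are such that the origin is asymptotically stable and is the unique equilibrium point, and (except perhaps at sets of measure zero) solutions exist and are unique in forward time on $[t_0,+\infty)$. **Settling time.** For an error system $\dot e_1=-h_1(e_1,t;T_c)+e_2$, $\dot e_2=-h_2(e_1,t;T_c)-\ddot y(t)$ with state $e=(e_1,e_2)$, $e(t;e_0,t_0,y_{[t_0,\infty)})$ denotes the solution with $e(t_0)=e_0\in\mathbb{R}^2$ for the admissible signal $y$ restricted to $[t_0,\infty)$, and $\mathcal{Y}_{[t_0,\infty)}$ is the set of admissible signals on $[t_0,\infty)$. The settling-time function is $$T(e_0,t_0)=\inf\left\{\xi\ge t_0:\ \forall y_{[t_0,\infty)}\in\mathcal{Y}_{[t_0,\infty)},\ \lim_{t\to\xi}e(t;e_0,t_0,y_{[t_0,\infty)})=0\right\}-t_0 .$$ The same definition is used for the settling-time function of the system with $\phi_1,\phi_2$ in place of $h_1,h_2$. An upper bound of the settling time (UBST) is a number $T_{\max}<+\infty$ with $T(e_0,t_0)\le T_{\max}$ for all $e_0\in\mathbb{R}^2$ and $t_0\in\mathbb{R}_+$; the least UBST is the smallest such number. *)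

theory Defs
  imports "HOL-Analysis.Analysis" "HOL-Computational_Algebra.Polynomial"
begin

section \<open>Filippov solutions\<close>

definition filippov_set :: "('a::euclidean_space \<Rightarrow> 'a) \<Rightarrow> 'a \<Rightarrow> 'a set" where
  "filippov_set f x =
     (\<Inter>\<delta>\<in>{0<..}. \<Inter>N\<in>{N. negligible N}. closure (convex hull (f ` (ball x \<delta> - N))))"

text \<open>Classical absolute continuity; the finite families of non-overlapping compact intervals
  are the divisions of their own unions.\<close>

definition abs_continuous_on :: "real set \<Rightarrow> (real \<Rightarrow> 'a::real_normed_vector) \<Rightarrow> bool" where
  "abs_continuous_on S x \<longleftrightarrow>
     (\<forall>\<epsilon>>0. \<exists>\<delta>>0. \<forall>D. D division_of (\<Union>D) \<and> \<Union>D \<subseteq> S \<and> (\<Sum>K\<in>D. measure lborel K) < \<delta>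
        \<longrightarrow> (\<Sum>K\<in>D. norm (x (Sup K) - x (Inf K))) < \<epsilon>)"

text \<open>Forward solutions on the whole half-line \<open>[t0, \<infinity>)\<close>.\<close>

definition filippov_solution ::
    "(real \<Rightarrow> 'a::euclidean_space \<Rightarrow> 'a) \<Rightarrow> real \<Rightarrow> (real \<Rightarrow> 'a) \<Rightarrow> bool" where
  "filippov_solution F t0 x \<longleftrightarrow>
     (\<forall>b\<ge>t0. abs_continuous_on {t0..b} x) \<and>
     (AE t in lebesgue. t0 \<le> t \<longrightarrow>
        (\<exists>v \<in> filippov_set (F t) (x t). (x has_vector_derivative v) (at t within {t0..})))"

section \<open>Signals\<close>

text \<open>Signals matter on \<open>[t0, \<infinity>)\<close> only, so the derivative at \<open>t0\<close> is one-sided.\<close>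

definition time_deriv :: "real \<Rightarrow> (real \<Rightarrow> real) \<Rightarrow> real \<Rightarrow> real" where
  "time_deriv t0 y t = vector_derivative y (at t within {t0..})"

text \<open>The first derivative is Lipschitz, so the second one exists, and is bounded, almost
  everywhere.\<close>

definition admissible_signals :: "(real \<Rightarrow> real) \<Rightarrow> real \<Rightarrow> (real \<Rightarrow> real) set" where
  "admissible_signals L t0 =
     {y. (\<forall>t\<ge>t0. y differentiable (at t within {t0..})) \<and>
         (\<exists>C. C-lipschitz_on {t0..} (time_deriv t0 y)) \<and>
         (AE t in lebesgue. t0 \<le> t \<longrightarrow>
            time_deriv t0 y differentiable (at t within {t0..}) \<and>
            \<bar>time_deriv t0 (time_deriv t0 y) t\<bar> \<le> L (t - t0))}"

text \<open>Bounds \<open>L\<close> are functions of the elapsed time \<open>s = t - t0 \<ge> 0\<close>.\<close>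

definition positive_log_rate_le :: "(real \<Rightarrow> real) \<Rightarrow> real \<Rightarrow> bool" where
  "positive_log_rate_le L M \<longleftrightarrow>
     (\<forall>s\<ge>0. 0 < L s \<and> L differentiable (at s within {0..}) \<and>
        (1 / L s) * \<bar>time_deriv 0 L s\<bar> \<le> M)"

section \<open>Error systems and settling time\<close>

definition error_system ::
    "(real \<Rightarrow> real \<Rightarrow> real) \<Rightarrow> (real \<Rightarrow> real \<Rightarrow> real) \<Rightarrow> real \<Rightarrow> (real \<Rightarrow> real) \<Rightarrow>
     real \<Rightarrow> real \<times> real \<Rightarrow> real \<times> real" where
  "error_system h1 h2 t0 y t =
     (\<lambda>(e1, e2). (- h1 e1 t + e2, - h2 e1 t - time_deriv t0 (time_deriv t0 y) t))"

definition differentiator ::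
    "(real \<Rightarrow> real \<Rightarrow> real) \<Rightarrow> (real \<Rightarrow> real \<Rightarrow> real) \<Rightarrow> (real \<Rightarrow> real) \<Rightarrow>
     real \<Rightarrow> real \<times> real \<Rightarrow> real \<times> real" where
  "differentiator h1 h2 y t = (\<lambda>(z0, z1). (- h1 (z0 - y t) t + z1, - h2 (z0 - y t) t))"

text \<open>In the following, \<open>Y t0\<close> is the set of signals on \<open>[t0, \<infinity>)\<close> and \<open>F t0 y\<close> the right-hand
  side of the system started at time \<open>t0\<close> and driven by \<open>y\<close>; the systems of interest depend on
  \<open>t0\<close> through \<open>t - t0\<close>. The value is infinite if there is no common settling instant.\<close>

definition settling_time ::
    "(real \<Rightarrow> (real \<Rightarrow> real) set) \<Rightarrow>
     (real \<Rightarrow> (real \<Rightarrow> real) \<Rightarrow> real \<Rightarrow> real \<times> real \<Rightarrow> real \<times> real) \<Rightarrow>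
     real \<times> real \<Rightarrow> real \<Rightarrow> ereal" where
  "settling_time Y F e0 t0 =
     Inf {ereal \<xi> | \<xi>. t0 \<le> \<xi> \<and>
        (\<forall>y\<in>Y t0. \<forall>e. filippov_solution (F t0 y) t0 e \<and> e t0 = e0 \<longrightarrow>
           (e \<longlongrightarrow> 0) (at \<xi> within {t0..}))} - ereal t0"

definition is_UBST :: "(real \<times> real \<Rightarrow> real \<Rightarrow> ereal) \<Rightarrow> real \<Rightarrow> bool" where
  "is_UBST T Tmax \<longleftrightarrow> (\<forall>e0. \<forall>t0\<ge>0. T e0 t0 \<le> ereal Tmax)"

definition is_least_UBST :: "(real \<times> real \<Rightarrow> real \<Rightarrow> ereal) \<Rightarrow> real \<Rightarrow> bool" where
  "is_least_UBST T Tmax \<longleftrightarrow> is_UBST T Tmax \<and> (\<forall>B. is_UBST T B \<longrightarrow> Tmax \<le> B)"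

definition globally_asymptotically_stable ::
    "(real \<Rightarrow> real \<times> real \<Rightarrow> real \<times> real) \<Rightarrow> real \<Rightarrow> bool" where
  "globally_asymptotically_stable F t0 \<longleftrightarrow>
     (\<forall>\<epsilon>>0. \<exists>\<delta>>0. \<forall>e. filippov_solution F t0 e \<and> norm (e t0) < \<delta> \<longrightarrow> (\<forall>t\<ge>t0. norm (e t) < \<epsilon>)) \<and>
     (\<forall>e. filippov_solution F t0 e \<longrightarrow> (e \<longlongrightarrow> 0) at_top)"

definition finite_time_stable ::
    "(real \<Rightarrow> (real \<Rightarrow> real) set) \<Rightarrow>
     (real \<Rightarrow> (real \<Rightarrow> real) \<Rightarrow> real \<Rightarrow> real \<times> real \<Rightarrow> real \<times> real) \<Rightarrow> bool" where
  "finite_time_stable Y F \<longleftrightarrow>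
     (\<forall>t0\<ge>0. (\<forall>y\<in>Y t0. globally_asymptotically_stable (F t0 y) t0) \<and>
        (\<forall>e0. settling_time Y F e0 t0 < \<infinity>))"

text \<open>Solutions exist in forward time, except possibly for a null set of initial states.\<close>

definition forward_complete ::
    "(real \<Rightarrow> (real \<Rightarrow> real) set) \<Rightarrow>
     (real \<Rightarrow> (real \<Rightarrow> real) \<Rightarrow> real \<Rightarrow> real \<times> real \<Rightarrow> real \<times> real) \<Rightarrow> real \<Rightarrow> bool" where
  "forward_complete Y F t0 \<longleftrightarrow>
     (\<forall>y\<in>Y t0. AE e0 in lborel. \<exists>e. filippov_solution (F t0 y) t0 e \<and> e t0 = e0)"

section \<open>The Levant--Livne system\<close>

record gains =
  lambda0 :: real
  lambda1 :: real
  mu0 :: real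
  mu1 :: real

text \<open>For \<open>a = 0\<close> this is \<open>sgn x\<close>, because \<open>z powr 0 = 1\<close> for \<open>z \<noteq> 0\<close>.\<close>

definition signed_power :: "real \<Rightarrow> real \<Rightarrow> real" where
  "signed_power x a = \<bar>x\<bar> powr a * sgn x"

definition phi1 :: "gains \<Rightarrow> real \<Rightarrow> real \<Rightarrow> real \<Rightarrow> real" where
  "phi1 g M l w = lambda1 g * sqrt l * signed_power w (1/2) + mu1 g * M * w"

definition phi2 :: "gains \<Rightarrow> real \<Rightarrow> real \<Rightarrow> real \<Rightarrow> real" where
  "phi2 g M l w =
     lambda0 g * l * sgn w + lambda1 g * mu0 g * sqrt l * M * signed_power w (1/2)
       + mu0 g * mu1 g * M\<^sup>2 * w"

definition phi_error_system ::
    "gains \<Rightarrow> (real \<Rightarrow> real) \<Rightarrow> real \<Rightarrow>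
     real \<Rightarrow> (real \<Rightarrow> real) \<Rightarrow> real \<Rightarrow> real \<times> real \<Rightarrow> real \<times> real" where
  "phi_error_system g L M t0 =
     error_system (\<lambda>w t. phi1 g M (L (t - t0)) w) (\<lambda>w t. phi2 g M (L (t - t0)) w) t0"

definition hurwitz_polynomial :: "real poly \<Rightarrow> bool" where
  "hurwitz_polynomial p \<longleftrightarrow> (\<forall>s::complex. poly (map_poly complex_of_real p) s = 0 \<longrightarrow> Re s < 0)"

text \<open>Gains are suitable if the finite-time stability theorem of Levant and Livne holds for
  them; the values these authors suggest are \<open>1.1\<close>, \<open>1.5\<close>, \<open>2\<close>, \<open>3\<close> in the order of the record.\<close>

definition suitable_gains :: "gains \<Rightarrow> bool" where
  "suitable_gains g \<longleftrightarrow>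
     (\<forall>L M. positive_log_rate_le L M \<longrightarrow>
        finite_time_stable (admissible_signals L) (phi_error_system g L M))"

section \<open>The predefined-time differentiator\<close>

definition time_map :: "real \<Rightarrow> real \<Rightarrow> real \<Rightarrow> real \<Rightarrow> real" where
  "time_map alpha Tc t0 t = - (1 / alpha) * ln (1 - (t - t0) / Tc)"

definition kappa :: "real \<Rightarrow> real \<Rightarrow> real \<Rightarrow> real" where
  "kappa alpha Tc s = 1 / (alpha * (Tc - s))"

text \<open>\<open>LL\<close> and \<open>MM\<close> are the bound and the rate constant in the new time scale.\<close>

definition pt_h1 ::
    "gains \<Rightarrow> real \<Rightarrow> real \<Rightarrow> (real \<Rightarrow> real) \<Rightarrow> real \<Rightarrow> (real \<Rightarrow> real) \<Rightarrow> real \<Rightarrow>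
     real \<Rightarrow> real \<Rightarrow> real \<Rightarrow> real" where
  "pt_h1 g alpha Tc L M LL MM t0 w t =
     (if t \<in> {t0..<t0 + Tc}
      then kappa alpha Tc (t - t0) * (- alpha * w + phi1 g MM (LL (time_map alpha Tc t0 t)) w)
      else phi1 g M (L (t - t0)) w)"

definition pt_h2 ::
    "gains \<Rightarrow> real \<Rightarrow> real \<Rightarrow> (real \<Rightarrow> real) \<Rightarrow> real \<Rightarrow> (real \<Rightarrow> real) \<Rightarrow> real \<Rightarrow>
     real \<Rightarrow> real \<Rightarrow> real \<Rightarrow> real" where
  "pt_h2 g alpha Tc L M LL MM t0 w t =
     (if t \<in> {t0..<t0 + Tc}
      then (kappa alpha Tc (t - t0))\<^sup>2 *
             (alpha\<^sup>2 * w + phi2 g MM (LL (time_map alpha Tc t0 t)) w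
                - alpha * phi1 g MM (LL (time_map alpha Tc t0 t)) w)
      else phi2 g M (L (t - t0)) w)"

definition pt_error_system ::
    "gains \<Rightarrow> real \<Rightarrow> real \<Rightarrow> (real \<Rightarrow> real) \<Rightarrow> real \<Rightarrow> (real \<Rightarrow> real) \<Rightarrow> real \<Rightarrow>
     real \<Rightarrow> (real \<Rightarrow> real) \<Rightarrow> real \<Rightarrow> real \<times> real \<Rightarrow> real \<times> real" where
  "pt_error_system g alpha Tc L M LL MM t0 =
     error_system (pt_h1 g alpha Tc L M LL MM t0) (pt_h2 g alpha Tc L M LL MM t0) t0"

end

theory Submission
  imports Defs
begin

text \<open>On \<open>[t0, t0 + Tc)\<close> put \<open>t = t0 + Tc * (1 - exp (- alpha * \<tau>))\<close> and
  \<open>x1 = e1\<close>, \<open>x2 = e2 / kappa + alpha * e1\<close>. In the time \<open>\<tau>\<close> the error system becomes the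
  Levant--Livne system with data \<open>LL\<close>, \<open>MM\<close>, driven by a signal whose second derivative is
  \<open>y'' / kappa^2\<close>. It settles at a finite \<open>\<tau>\<close>, that is, before \<open>t0 + Tc\<close>; afterwards stability of the
  Levant--Livne system, restarted at \<open>t0 + Tc\<close> with the shifted bound \<open>L\<close>, keeps the error at zero.

  The bound \<open>Tc\<close> is the least one because on \<open>[t0, t0 + b]\<close> with \<open>b < Tc\<close> the right-hand side grows at
  most linearly in the state: a Gronwall estimate keeps solutions that start far from the origin away
  from it up to the time \<open>t0 + b\<close>, and such solutions exist by forward completeness.\<close>

text \<open>The form of \<open>x2\<close> is forced: with \<open>r = 1 / kappa\<close> the
  \<open>\<tau>\<close>-derivative of \<open>x1\<close> is
  \<open>- phi1 + (r * e2 + alpha * e1)\<close>, and since \<open>r' = - alpha * r\<close>, every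
  extra term of \<open>pt_h1\<close> and \<open>pt_h2\<close> cancels in the derivative of
  \<open>x2\<close>. The obstacle is that this takes place inside a differential inclusion. It is
  met by computing each Filippov set exactly: every field is continuous up to one multiple of
  \<open>sgn\<close> in its second component, so its set is parametrised by a selection
  \<open>s\<close> of the set-valued sign, and the change of variables preserves \<open>s\<close>
  because it preserves \<open>e1\<close>. Two gaps remain: the new time never reaches
  \<open>t0 + Tc\<close>, so the value there comes from continuity; and a settling instant yields
  only a limit at that instant, so permanence at zero within the new time scale needs stability as
  well.\<close>

lemma AE_lebesgue_iff_negligible: "(AE t in lebesgue. P t) \<longleftrightarrow> negligible {t. \<not> P t}"
  by (simp add: completion.AE_iff_null_sets negligible_iff_null_sets)

section \<open>Absolute continuity\<close>

lemma division_interval: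
  fixes K :: "real set"
  assumes "D division_of S" "K \<in> D"
  shows "K = {Inf K..Sup K}" "Inf K \<le> Sup K" "Inf K \<in> S" "Sup K \<in> S"
proof -
  obtain a b where K: "K = {a..b}"
    using assms by (metis division_ofD(4) cbox_interval)
  have "K \<noteq> {}" using assms by auto
  with K have "a \<le> b" by auto
  then show "K = {Inf K..Sup K}" "Inf K \<le> Sup K" using K by auto
  moreover have "K \<subseteq> S" using assms by auto
  ultimately show "Inf K \<in> S" "Sup K \<in> S" by auto
qed

lemma abs_continuous_onE:
  assumes "abs_continuous_on S x" "\<epsilon> > 0"
  obtains \<delta> where "\<delta> > 0"
    "\<And>D. D division_of (\<Union>D) \<Longrightarrow> \<Union>D \<subseteq> S \<Longrightarrow> (\<Sum>K\<in>D. measure lborel K) < \<delta> \<Longrightarrow>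
      (\<Sum>K\<in>D. norm (x (Sup K) - x (Inf K))) < \<epsilon>"
  using assms unfolding abs_continuous_on_def by metis

lemma abs_continuous_on_subset:
  "abs_continuous_on S x \<Longrightarrow> T \<subseteq> S \<Longrightarrow> abs_continuous_on T x"
  unfolding abs_continuous_on_def by (meson order_trans)

text \<open>A common source for the closure properties below: Lipschitz maps, linear images, sums,
  pairs and products are all instances, because their increments are controlled by those of at most
  two absolutely continuous functions.\<close>

lemma abs_continuous_on_dominated:
  assumes "abs_continuous_on S f" "abs_continuous_on S g"
    and "\<And>u v. u \<in> S \<Longrightarrow> v \<in> S \<Longrightarrow> norm (h v - h u) \<le> C * (norm (f v - f u) + norm (g v - g u))"
  shows "abs_continuous_on S h"
  unfolding abs_continuous_on_def
proof (intro allI impI)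
  fix \<epsilon> :: real assume "\<epsilon> > 0"
  \<comment> \<open>\<open>C\<close> may be zero or negative; \<open>C'\<close> can be divided
    by.\<close>
  define C' where "C' = max C 1"
  have C': "C' \<ge> 1" "C \<le> C'" by (auto simp: C'_def)
  have "\<epsilon> / (2 * C') > 0" using \<open>\<epsilon> > 0\<close> C' by simp
  from abs_continuous_onE[OF assms(1) this] abs_continuous_onE[OF assms(2) this]
  obtain \<delta>1 \<delta>2 where \<delta>: "\<delta>1 > 0" "\<delta>2 > 0"
    and 1: "\<And>D. D division_of (\<Union>D) \<Longrightarrow> \<Union>D \<subseteq> S \<Longrightarrow> (\<Sum>K\<in>D. measure lborel K) < \<delta>1 \<Longrightarrow>
      (\<Sum>K\<in>D. norm (f (Sup K) - f (Inf K))) < \<epsilon> / (2 * C')"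
    and 2: "\<And>D. D division_of (\<Union>D) \<Longrightarrow> \<Union>D \<subseteq> S \<Longrightarrow> (\<Sum>K\<in>D. measure lborel K) < \<delta>2 \<Longrightarrow>
      (\<Sum>K\<in>D. norm (g (Sup K) - g (Inf K))) < \<epsilon> / (2 * C')"
    by (smt (verit, best))
  show "\<exists>\<delta>>0. \<forall>D. D division_of \<Union> D \<and> \<Union> D \<subseteq> S \<and> (\<Sum>K\<in>D. measure lborel K) < \<delta> \<longrightarrow>
           (\<Sum>K\<in>D. norm (h (Sup K) - h (Inf K))) < \<epsilon>"
  proof (intro exI[of _ "min \<delta>1 \<delta>2"] conjI allI impI)
    fix D assume D: "D division_of \<Union> D \<and> \<Union> D \<subseteq> S \<and> (\<Sum>K\<in>D. measure lborel K) < min \<delta>1 \<delta>2"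
    have "(\<Sum>K\<in>D. norm (h (Sup K) - h (Inf K)))
        \<le> (\<Sum>K\<in>D. C' * (norm (f (Sup K) - f (Inf K)) + norm (g (Sup K) - g (Inf K))))"
    proof (rule sum_mono)
      fix K assume "K \<in> D"
      with D have "Inf K \<in> S" "Sup K \<in> S" using division_interval[of D "\<Union>D" K] by auto
      then have "norm (h (Sup K) - h (Inf K))
          \<le> C * (norm (f (Sup K) - f (Inf K)) + norm (g (Sup K) - g (Inf K)))"
        using assms(3) by blast
      also have "\<dots> \<le> C' * (norm (f (Sup K) - f (Inf K)) + norm (g (Sup K) - g (Inf K)))"
        using C' by (intro mult_right_mono) auto
      finally show "norm (h (Sup K) - h (Inf K)) \<le> \<dots>" .
    qed
    also have "\<dots> = C' * ((\<Sum>K\<in>D. norm (f (Sup K) - f (Inf K))) + (\<Sum>K\<in>D. norm (g (Sup K) - g (Inf K))))"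
      by (simp add: sum_distrib_left[symmetric] sum.distrib)
    also have "\<dots> < C' * (\<epsilon> / (2 * C') + \<epsilon> / (2 * C'))"
      using 1[of D] 2[of D] D C' by (intro mult_strict_left_mono add_strict_mono) auto
    also have "\<dots> = \<epsilon>" using C' by (simp add: field_simps)
    finally show "(\<Sum>K\<in>D. norm (h (Sup K) - h (Inf K))) < \<epsilon>" .
  qed (use \<delta> in auto)
qed

lemma abs_continuous_on_id: "abs_continuous_on S (\<lambda>t. t)"
  unfolding abs_continuous_on_def
proof (intro allI impI)
  fix \<epsilon> :: real assume "\<epsilon> > 0"
  have "(\<Sum>K\<in>D. norm (Sup K - Inf K)) = (\<Sum>K\<in>D. measure lborel K)"
    if "D division_of \<Union>D" for D :: "real set set"
  proof (rule sum.cong)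
    fix K assume "K \<in> D"
    with division_interval(1,2)[OF that this] show "norm (Sup K - Inf K) = measure lborel K"
      by (metis content_real real_norm_def abs_of_nonneg diff_ge_0_iff_ge)
  qed simp
  then show "\<exists>\<delta>>0. \<forall>D. D division_of \<Union> D \<and> \<Union> D \<subseteq> S \<and> (\<Sum>K\<in>D. measure lborel K) < \<delta> \<longrightarrow>
           (\<Sum>K\<in>D. norm (Sup K - Inf K)) < \<epsilon>"
    using \<open>\<epsilon> > 0\<close> by auto
qed

lemma lipschitz_imp_abs_continuous_on:
  assumes "C-lipschitz_on S f"
  shows "abs_continuous_on S f"
proof (rule abs_continuous_on_dominated[OF abs_continuous_on_id abs_continuous_on_id])
  fix u v assume "u \<in> S" "v \<in> S"
  then have "norm (f v - f u) \<le> C * norm (v - u)" "C \<ge> 0"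
    using assms by (auto dest: lipschitz_onD lipschitz_on_nonneg simp: dist_norm)
  moreover have "C * norm (v - u) \<le> C * (norm (v - u) + norm (v - u))"
    using \<open>C \<ge> 0\<close> by (intro mult_left_mono) auto
  ultimately show "norm (f v - f u) \<le> C * (norm (v - u) + norm (v - u))" by linarith
qed

text \<open>A single compact interval is a division of itself, so the condition contains uniform
  continuity.\<close>

lemma abs_continuous_on_imp_continuous_on:
  fixes f :: "real \<Rightarrow> 'a::real_normed_vector"
  assumes "abs_continuous_on {a..b} f"
  shows "continuous_on {a..b} f"
  unfolding continuous_on_iff
proof (intro ballI allI impI)
  fix t and e :: real assume t: "t \<in> {a..b}" and "e > 0"
  from abs_continuous_onE[OF assms this(2)]
  obtain \<delta> where \<delta>: "\<delta> > 0"
    and *: "\<And>D. D division_of (\<Union>D) \<Longrightarrow> \<Union>D \<subseteq> {a..b} \<Longrightarrow> (\<Sum>K\<in>D. measure lborel K) < \<delta> \<Longrightarrow>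
      (\<Sum>K\<in>D. norm (f (Sup K) - f (Inf K))) < e" by blast
  have **: "norm (f v - f u) < e" if "u \<le> v" "u \<in> {a..b}" "v \<in> {a..b}" "v - u < \<delta>" for u v
    using *[of "{{u..v}}"] that division_of_self[of u v] by auto
  show "\<exists>d>0. \<forall>x'\<in>{a..b}. dist x' t < d \<longrightarrow> dist (f x') (f t) < e"
  proof (intro exI[of _ \<delta>] conjI ballI impI \<delta>)
    fix s assume "s \<in> {a..b}" "dist s t < \<delta>"
    then show "dist (f s) (f t) < e"
      using **[of s t] **[of t s] t by (cases "s \<le> t") (auto simp: dist_norm dist_real_def norm_minus_commute)
  qed
qed

lemma abs_continuous_on_bounded_linear:
  assumes "abs_continuous_on S f" "bounded_linear T"
  shows "abs_continuous_on S (\<lambda>t. T (f t))"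
proof -
  obtain C where C: "\<And>x. norm (T x) \<le> norm x * C" using assms(2) bounded_linear.bounded by blast
  show ?thesis
  \<comment> \<open>The constant \<open>0\<close> fills the second slot of the two-function
    criterion.\<close>
  proof (rule abs_continuous_on_dominated[OF assms(1) lipschitz_imp_abs_continuous_on[OF lipschitz_on_constant]])
    fix u v
    have "norm (T (f v - f u)) \<le> norm (f v - f u) * C" by (rule C)
    then show "norm (T (f v) - T (f u)) \<le> C * (norm (f v - f u) + norm (0 - 0 :: real))"
      using bounded_linear.linear[OF assms(2)] by (simp add: linear_diff mult.commute)
  qed
qed

lemma abs_continuous_on_add:
  assumes "abs_continuous_on S f" "abs_continuous_on S g"
  shows "abs_continuous_on S (\<lambda>t. f t + g t)"
proof (rule abs_continuous_on_dominated[OF assms, of _ 1])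
  fix u v
  show "norm (f v + g v - (f u + g u)) \<le> 1 * (norm (f v - f u) + norm (g v - g u))"
    by (simp add: add_diff_add norm_triangle_ineq)
qed

lemma abs_continuous_on_diff:
  assumes "abs_continuous_on S f" "abs_continuous_on S g"
  shows "abs_continuous_on S (\<lambda>t. f t - g t)"
  using abs_continuous_on_add[OF assms(1) abs_continuous_on_bounded_linear[OF assms(2) bounded_linear_minus[OF bounded_linear_ident]]]
  by simp

lemma abs_continuous_on_Pair:
  assumes "abs_continuous_on S f" "abs_continuous_on S g"
  shows "abs_continuous_on S (\<lambda>t. (f t, g t))"
proof (rule abs_continuous_on_dominated[OF assms, of _ 1])
  fix u v
  show "norm ((f v, g v) - (f u, g u)) \<le> 1 * (norm (f v - f u) + norm (g v - g u))"
    using norm_Pair_le by simp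
qed

text \<open>On a compact interval both factors are bounded, so the increment of the product is
  dominated by the increments of the factors.\<close>

lemma abs_continuous_on_mult:
  fixes f g :: "real \<Rightarrow> real"
  assumes f: "abs_continuous_on {a..b} f" and g: "abs_continuous_on {a..b} g"
  shows "abs_continuous_on {a..b} (\<lambda>t. f t * g t)"
proof -
  have "bounded (f ` {a..b})" "bounded (g ` {a..b})"
    using f g by (auto intro!: compact_imp_bounded compact_continuous_image
        abs_continuous_on_imp_continuous_on)
  then have "\<exists>A. \<forall>t\<in>{a..b}. \<bar>f t\<bar> \<le> A" "\<exists>B. \<forall>t\<in>{a..b}. \<bar>g t\<bar> \<le> B"
    unfolding bounded_iff by auto
  then obtain A B where A: "\<And>t. t \<in> {a..b} \<Longrightarrow> \<bar>f t\<bar> \<le> A" and B: "\<And>t. t \<in> {a..b} \<Longrightarrow> \<bar>g t\<bar> \<le> B"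
    by metis
  show ?thesis
  proof (rule abs_continuous_on_dominated[OF f g])
    fix u v assume u: "u \<in> {a..b}" and v: "v \<in> {a..b}"
    have "f v * g v - f u * g u = (f v - f u) * g v + f u * (g v - g u)" by (simp add: algebra_simps)
    then have "norm (f v * g v - f u * g u) \<le> \<bar>f v - f u\<bar> * \<bar>g v\<bar> + \<bar>f u\<bar> * \<bar>g v - g u\<bar>"
      by (metis abs_triangle_ineq abs_mult real_norm_def)
    also have "\<dots> \<le> \<bar>f v - f u\<bar> * max A B + max A B * \<bar>g v - g u\<bar>"
      using A[OF u] B[OF v] by (intro add_mono mult_left_mono mult_right_mono) auto
    finally show "norm (f v * g v - f u * g u) \<le> max A B * (norm (f v - f u) + norm (g v - g u))"
      by (simp add: algebra_simps)
  qed
qed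

text \<open>A strictly increasing \<open>p\<close> carries non-overlapping intervals to
  non-overlapping intervals, and the Lipschitz constant controls their total length; hence a
  division of the domain becomes an admissible division for \<open>f\<close>. Monotonicity is what
  prevents the images from overlapping.\<close>

lemma abs_continuous_on_compose_strict_mono:
  fixes p :: "real \<Rightarrow> real"
  assumes f: "abs_continuous_on T f" and p: "C-lipschitz_on {a..b} p" "strict_mono_on {a..b} p"
    and sub: "p ` {a..b} \<subseteq> T"
  shows "abs_continuous_on {a..b} (\<lambda>t. f (p t))"
  unfolding abs_continuous_on_def
proof (intro allI impI)
  fix \<epsilon> :: real assume "\<epsilon> > 0"
  from abs_continuous_onE[OF f this]
  obtain \<delta> where \<delta>: "\<delta> > 0"
    and *: "\<And>D. D division_of (\<Union>D) \<Longrightarrow> \<Union>D \<subseteq> T \<Longrightarrow> (\<Sum>K\<in>D. measure lborel K) < \<delta> \<Longrightarrow>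
      (\<Sum>K\<in>D. norm (f (Sup K) - f (Inf K))) < \<epsilon>" by blast
  define C' where "C' = max C 1"
  have C': "C' > 0" "C \<le> C'" by (auto simp: C'_def)
  show "\<exists>\<delta>>0. \<forall>D. D division_of \<Union> D \<and> \<Union> D \<subseteq> {a..b} \<and> (\<Sum>K\<in>D. measure lborel K) < \<delta> \<longrightarrow>
           (\<Sum>K\<in>D. norm (f (p (Sup K)) - f (p (Inf K)))) < \<epsilon>"
  proof (intro exI[of _ "\<delta> / C'"] conjI allI impI)
    fix D assume D: "D division_of \<Union> D \<and> \<Union> D \<subseteq> {a..b} \<and> (\<Sum>K\<in>D. measure lborel K) < \<delta> / C'"
    define q where "q K = {p (Inf K)..p (Sup K)}" for K :: "real set"
    have K: "K = {Inf K..Sup K}" "Inf K \<le> Sup K" "Inf K \<in> {a..b}" "Sup K \<in> {a..b}" if "K \<in> D" for K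
      using division_interval[of D "\<Union>D" K] D that by auto
    have ple: "p u \<le> p v" if "u \<in> {a..b}" "v \<in> {a..b}" "u \<le> v" for u v
      using p(2) that by (metis strict_mono_on_leD)
    have pinj: "p u \<le> p v \<longleftrightarrow> u \<le> v" if "u \<in> {a..b}" "v \<in> {a..b}" for u v
      using p(2) that ple by (metis linorder_not_le strict_mono_onD)
    \<comment> \<open>\<open>T\<close> is only known to contain the image of \<open>{a..b}\<close>,
      so the interval between the endpoint values has to be identified with the image of
      \<open>K\<close>; the intermediate value theorem gives the hard inclusion.\<close>
    have qK: "q K = p ` K" if kD: "K \<in> D" for K
    proof
      have "continuous_on {Inf K..Sup K} p"
        using K(3,4)[OF kD] by (intro lipschitz_on_continuous_on[OF lipschitz_on_subset[OF p(1)]]) auto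
      then have "\<exists>t\<ge>Inf K. t \<le> Sup K \<and> p t = s" if "s \<in> q K" for s
        using IVT'[of p "Inf K" s "Sup K"] that K(2)[OF kD] by (auto simp: q_def)
      then have "q K \<subseteq> p ` {Inf K..Sup K}" by force
      then show "q K \<subseteq> p ` K" using K(1)[OF kD] by metis
      show "p ` K \<subseteq> q K"
      proof
        fix x assume "x \<in> p ` K"
        then obtain t where t: "t \<in> K" "x = p t" by blast
        then have "Inf K \<le> t" "t \<le> Sup K" using K(1)[OF kD] by (metis atLeastAtMost_iff)+
        then show "x \<in> q K" using K(3,4)[OF kD] ple t(2) by (auto simp: q_def)
      qed
    qed
    have Inf_q: "Inf (q K) = p (Inf K)" "Sup (q K) = p (Sup K)" if "K \<in> D" for K
      using ple[OF K(3,4,2)[OF that]] by (auto simp: q_def)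
    have inj: "inj_on q D"
    proof (rule inj_onI)
      fix K K' assume k: "K \<in> D" "K' \<in> D" "q K = q K'"
      then have "p (Inf K) = p (Inf K')" "p (Sup K) = p (Sup K')"
        unfolding Inf_q[OF k(1), symmetric] Inf_q[OF k(2), symmetric] by simp_all
      then have "Inf K = Inf K'" "Sup K = Sup K'"
        using pinj[OF K(3)[OF k(1)] K(3)[OF k(2)]] pinj[OF K(3)[OF k(2)] K(3)[OF k(1)]]
          pinj[OF K(4)[OF k(1)] K(4)[OF k(2)]] pinj[OF K(4)[OF k(2)] K(4)[OF k(1)]] by linarith+
      then have "{Inf K..Sup K} = {Inf K'..Sup K'}" by simp
      then show "K = K'"
        by (rule trans[OF K(1)[OF k(1)] trans[OF _ K(1)[OF k(2), symmetric]]])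
    qed
    have div: "q ` D division_of \<Union> (q ` D)"
    proof (rule division_ofI)
      show "finite (q ` D)" using D division_of_finite by blast
      show "\<exists>c d. L = cbox c d" if "L \<in> q ` D" for L
        using that unfolding q_def cbox_interval by blast
      show "L \<noteq> {}" if "L \<in> q ` D" for L
      proof -
        from that obtain K where k: "K \<in> D" "L = q K" by blast
        then have "p (Inf K) \<in> L" using ple[OF K(3,4,2)[OF k(1)]] by (simp add: q_def)
        then show ?thesis by blast
      qed
      fix L L' assume L: "L \<in> q ` D" "L' \<in> q ` D" "L \<noteq> L'"
      then obtain K1 K2 where k: "K1 \<in> D" "K2 \<in> D" "L = q K1" "L' = q K2" "K1 \<noteq> K2" by blast
      have int: "interior K = {Inf K<..<Sup K}" if "K \<in> D" for K
        by (rule trans[OF arg_cong[OF K(1)[OF that], of interior] interior_atLeastAtMost_real])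
      have "interior K1 \<inter> interior K2 = {}" by (rule division_ofD(5)[OF conjunct1[OF D] k(1,2,5)])
      then have "{Inf K1<..<Sup K1} \<inter> {Inf K2<..<Sup K2} = {}"
        unfolding int[OF k(1)] int[OF k(2)] .
      then have "\<not> (max (Inf K1) (Inf K2) < z \<and> z < min (Sup K1) (Sup K2))" for z
        by (metis disjoint_iff greaterThanLessThan_iff max_less_iff_conj min_less_iff_conj)
      then have "max (Inf K1) (Inf K2) \<ge> min (Sup K1) (Sup K2)"
        by (metis dense not_less)
      \<comment> \<open>Disjointness of the interiors becomes a comparison of endpoints, which
        \<open>p\<close> transports. The first and last alternatives are the degenerate
        intervals.\<close>
      then have "Sup K1 \<le> Inf K1 \<or> Sup K1 \<le> Inf K2 \<or> Sup K2 \<le> Inf K1 \<or> Sup K2 \<le> Inf K2"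
        by linarith
      then have "p (Sup K1) \<le> p (Inf K1) \<or> p (Sup K1) \<le> p (Inf K2) \<or> p (Sup K2) \<le> p (Inf K1)
          \<or> p (Sup K2) \<le> p (Inf K2)"
        using pinj[OF K(4)[OF k(1)] K(3)[OF k(1)]] pinj[OF K(4)[OF k(1)] K(3)[OF k(2)]]
          pinj[OF K(4)[OF k(2)] K(3)[OF k(1)]] pinj[OF K(4)[OF k(2)] K(3)[OF k(2)]] by argo
      then have "{p (Inf K1)<..<p (Sup K1)} \<inter> {p (Inf K2)<..<p (Sup K2)} = {}"
        by (elim disjE) auto
      then show "interior L \<inter> interior L' = {}"
        unfolding k q_def interior_atLeastAtMost_real .
    qed auto
    have sub': "\<Union> (q ` D) \<subseteq> T"
    proof (rule Union_least)
      fix L assume "L \<in> q ` D"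
      then obtain K where k: "K \<in> D" "L = q K" by blast
      then have "K \<subseteq> {a..b}" using D by blast
      then show "L \<subseteq> T" using qK[OF k(1)] k(2) sub by blast
    qed
    have "(\<Sum>K\<in>q ` D. measure lborel K) = (\<Sum>K\<in>D. measure lborel (q K))"
      using sum.reindex[OF inj] by auto
    also have "\<dots> \<le> (\<Sum>K\<in>D. C' * measure lborel K)"
    proof (rule sum_mono)
      fix K assume k: "K \<in> D"
      have "p (Sup K) - p (Inf K) \<le> C * (Sup K - Inf K)"
        using lipschitz_onD[OF p(1) K(4,3)[OF k]] K(2)[OF k] by (simp add: dist_real_def)
      also have "\<dots> \<le> C' * (Sup K - Inf K)" using C' K(2)[OF k] by (intro mult_right_mono) auto
      finally have "p (Sup K) - p (Inf K) \<le> C' * (Sup K - Inf K)" .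
      moreover have "measure lborel (q K) = p (Sup K) - p (Inf K)"
        using ple[OF K(3,4,2)[OF k]] by (simp add: q_def)
      moreover have "measure lborel K = Sup K - Inf K"
        by (rule trans[OF arg_cong[OF K(1)[OF k], of "measure lborel"] content_real[OF K(2)[OF k]]])
      ultimately show "measure lborel (q K) \<le> C' * measure lborel K" by simp
    qed
    also have "\<dots> < \<delta>"
      using D C' by (simp add: sum_distrib_left[symmetric] field_simps)
    finally have "(\<Sum>K\<in>q ` D. norm (f (Sup K) - f (Inf K))) < \<epsilon>"
      using *[OF div sub'] by blast
    then show "(\<Sum>K\<in>D. norm (f (p (Sup K)) - f (p (Inf K)))) < \<epsilon>"
      using sum.reindex[OF inj, of "\<lambda>K. norm (f (Sup K) - f (Inf K))"] Inf_q by (simp cong: sum.cong)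
  qed (use \<delta> C' in auto)
qed

text \<open>On a fine tagged division, the intervals tagged in the exceptional null set have small total
  length, so they contribute little by absolute continuity; on the others the function increases up
  to a small multiple of the length.\<close>

lemma abs_continuous_on_AE_deriv_nonneg:
  fixes f :: "real \<Rightarrow> real"
  assumes ac: "abs_continuous_on {a..b} f" and ab: "a \<le> b"
    and neg: "negligible N"
    and der: "\<And>t. t \<in> {a..b} - N \<Longrightarrow> \<exists>d\<ge>0. (f has_real_derivative d) (at t within {a..b})"
  shows "f a \<le> f b"
proof (rule field_le_epsilon)
  fix \<epsilon>0 :: real assume "\<epsilon>0 > 0"
  \<comment> \<open>The total error will be \<open>\<epsilon>\<close> from the tags in
    \<open>N\<close> plus \<open>\<epsilon> * (b - a)\<close> from the others.\<close>
  define \<epsilon> where "\<epsilon> = \<epsilon>0 / (1 + (b - a))"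
  have \<epsilon>: "\<epsilon> > 0" "\<epsilon> * (1 + (b - a)) = \<epsilon>0" using \<open>\<epsilon>0 > 0\<close> ab by (auto simp: \<epsilon>_def)
  from abs_continuous_onE[OF ac \<epsilon>(1)]
  obtain \<delta> where \<delta>: "\<delta> > 0"
    and *: "\<And>D. D division_of (\<Union>D) \<Longrightarrow> \<Union>D \<subseteq> {a..b} \<Longrightarrow> (\<Sum>K\<in>D. measure lborel K) < \<delta> \<Longrightarrow>
      (\<Sum>K\<in>D. norm (f (Sup K) - f (Inf K))) < \<epsilon>" by blast
  have N: "N \<in> sets lebesgue" "measure lebesgue N = 0" "N \<in> lmeasurable"
    using neg by (auto simp: negligible_iff_measure)
  \<comment> \<open>Intervals tagged in \<open>N\<close> will be forced into \<open>U\<close>, so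
    their total length stays below the \<open>\<delta>\<close> of absolute continuity.\<close>
  obtain U where U: "open U" "N \<subseteq> U" "U \<in> lmeasurable" "measure lebesgue U < \<delta>"
  proof -
    from sets_lebesgue_outer_open[OF N(1) \<delta>] obtain T where
      T: "open T" "N \<subseteq> T" "T - N \<in> lmeasurable" "emeasure lebesgue (T - N) < ennreal \<delta>" by blast
    have eq: "T = N \<union> (T - N)" using T by auto
    then have "T \<in> lmeasurable" using N(3) T(3) by (metis fmeasurable.Un)
    moreover have "measure lebesgue T < \<delta>"
    proof -
      have "measure lebesgue T \<le> measure lebesgue N + measure lebesgue (T - N)"
        using measure_Un_le[of N lebesgue "T - N"] N T eq by auto
      moreover have "measure lebesgue (T - N) < \<delta>"
        using T(3,4) \<delta> by (simp add: emeasure_eq_measure2 ennreal_less_iff)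
      ultimately show ?thesis using N by simp
    qed
    ultimately show ?thesis using that T by blast
  qed
  \<comment> \<open>The radius serves both kinds of tags. Outside \<open>N\<close> it comes from the
    straddle estimate: when the tag lies between \<open>u\<close> and \<open>v\<close>,
    differentiability at the tag bounds the increment over the whole interval.\<close>
  have "\<exists>r>0. (t \<in> N \<longrightarrow> ball t r \<subseteq> U) \<and> (t \<in> {a..b} - N \<longrightarrow>
      (\<forall>u v. u \<le> t \<and> t \<le> v \<and> u \<in> {a..b} \<inter> ball t r \<and> v \<in> {a..b} \<inter> ball t r \<longrightarrow>
         f v - f u \<ge> - \<epsilon> * (v - u)))" for t
  proof (cases "t \<in> N")
    case True
    then show ?thesis using U by (meson DiffD2 open_contains_ball subsetD)
  next
    case False
    show ?thesis
    proof (cases "t \<in> {a..b}")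
      case True
      with False der obtain d where d: "d \<ge> 0" "(f has_real_derivative d) (at t within {a..b})" by blast
      then have "(f has_derivative (\<lambda>h. d * h)) (at t within {a..b})"
        by (simp add: has_field_derivative_def)
      with \<epsilon>(1) obtain r where r: "r > 0"
        "\<And>s. s \<in> {a..b} \<Longrightarrow> norm (s - t) < r \<Longrightarrow> norm (f s - f t - d * (s - t)) \<le> \<epsilon> * norm (s - t)"
        unfolding has_derivative_within_alt by blast
      have "f v - f u \<ge> - \<epsilon> * (v - u)"
        if "u \<le> t" "t \<le> v" "u \<in> {a..b} \<inter> ball t r" "v \<in> {a..b} \<inter> ball t r" for u v
      proof -
        have "\<bar>f v - f t - d * (v - t)\<bar> \<le> \<epsilon> * (v - t)" "\<bar>f u - f t - d * (u - t)\<bar> \<le> \<epsilon> * (t - u)"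
          using r(2)[of u] r(2)[of v] that by (auto simp: dist_real_def)
        moreover have "d * (v - t) \<ge> 0" "d * (u - t) \<le> 0"
          using d that by (auto intro: mult_nonneg_nonpos)
        moreover have "- \<epsilon> * (v - u) = - (\<epsilon> * (v - t)) - \<epsilon> * (t - u)" by (simp add: algebra_simps)
        ultimately show ?thesis by linarith
      qed
      with r(1) False show ?thesis by blast
    qed (use False in \<open>auto intro: zero_less_one\<close>)
  qed
  then obtain r where r: "\<And>t. r t > 0" "\<And>t. t \<in> N \<Longrightarrow> ball t (r t) \<subseteq> U"
    "\<And>t u v. t \<in> {a..b} - N \<Longrightarrow> u \<le> t \<Longrightarrow> t \<le> v \<Longrightarrow> u \<in> {a..b} \<inter> ball t (r t) \<Longrightarrow>
       v \<in> {a..b} \<inter> ball t (r t) \<Longrightarrow> f v - f u \<ge> - \<epsilon> * (v - u)"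
    by metis
  have "gauge (\<lambda>t. ball t (r t))" using r(1) by (simp add: gauge_ball_dependent)
  then obtain p where p: "p tagged_division_of {a..b}" "(\<lambda>t. ball t (r t)) fine p"
    using fine_division_exists_real by blast
  have fin: "finite p" using p(1) by auto
  have K: "K = {Inf K..Sup K} \<and> Inf K \<le> t \<and> t \<le> Sup K \<and> K \<subseteq> {a..b} \<and> K \<subseteq> ball t (r t)"
    if tK: "(t, K) \<in> p" for t K
  proof -
    obtain c d where cd: "K = {c..d}" using p(1) tK by (metis tagged_division_ofD(4) cbox_interval)
    have "t \<in> K" "K \<subseteq> {a..b}" using p(1) tK by auto
    then show ?thesis using cd fineD[OF p(2) tK] by auto
  qed
  define P where "P = {x \<in> p. fst x \<in> N}"
  have split: "sum h p = sum h P + sum h (p - P)" for h :: "_ \<Rightarrow> real"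
    using sum.subset_diff[of P p h] fin by (simp add: P_def add.commute)
  let ?g = "\<lambda>K. f (Sup K) - f (Inf K)"
  have sum1: "(\<Sum>x\<in>P. \<bar>?g (snd x)\<bar>) < \<epsilon>"
  proof -
    have "P tagged_partial_division_of {a..b}"
      using p(1) unfolding tagged_division_of_def P_def by (auto intro: tagged_partial_division_subset)
    note pd = partial_division_of_tagged_division[OF this] and pd' = tagged_partial_division_ofD[OF this]
    \<comment> \<open>The same interval may carry two different tags only if its interior is empty;
      it is then a point and contributes nothing, so summing over intervals instead of tagged pairs
      is harmless.\<close>
    have "(\<Sum>K\<in>snd ` P. \<bar>?g K\<bar>) = (\<Sum>x\<in>P. \<bar>?g (snd x)\<bar>)"
    proof (subst sum.reindex_nontrivial)
      show "finite P" using fin by (simp add: P_def)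
      fix x y assume xy: "x \<in> P" "y \<in> P" "x \<noteq> y" "snd x = snd y"
      then have "interior (snd x) = {}" using pd'(5)[of "fst x" "snd x" "fst y" "snd y"]
        by (metis inf.idem prod.collapse)
      moreover have "(fst x, snd x) \<in> p" using xy(1) by (simp add: P_def)
      ultimately have "Inf (snd x) = Sup (snd x)"
        using K[of "fst x" "snd x"] interior_atLeastAtMost_real
        by (metis greaterThanLessThan_empty_iff order_antisym order_trans)
      then show "\<bar>?g (snd x)\<bar> = 0" by simp
    qed simp
    moreover have "(\<Sum>K\<in>snd ` P. measure lborel K) < \<delta>"
    proof -
      have "(\<Sum>K\<in>snd ` P. measure lborel K) = (\<Sum>K\<in>snd ` P. measure lebesgue K)"
      proof (rule sum.cong[OF refl])
        fix L assume "L \<in> snd ` P"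
        then obtain c d where "L = cbox c d" using pd by (metis division_ofD(4))
        then show "measure lborel L = measure lebesgue L" by simp
      qed
      also have "\<dots> = measure lebesgue (\<Union> (snd ` P))" by (rule content_division[OF pd])
      also have "\<dots> \<le> measure lebesgue U"
      proof (rule measure_mono_fmeasurable)
        show "\<Union> (snd ` P) \<subseteq> U" using K r(2) unfolding P_def by (smt (verit) UN_iff Union_iff image_iff mem_Collect_eq prod.collapse subset_iff)
        show "\<Union> (snd ` P) \<in> sets lebesgue"
          using pd by (metis fmeasurableD lmeasurable_division)
      qed (use U in auto)
      finally show ?thesis using U by simp
    qed
    moreover have "\<Union> (snd ` P) \<subseteq> {a..b}" using pd'(3) by fastforce
    ultimately show ?thesis using *[OF pd] by simp
  qed
  have sum2: "(\<Sum>x\<in>p - P. ?g (snd x)) \<ge> - \<epsilon> * (b - a)"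
  proof -
    have "- \<epsilon> * (b - a) = (\<Sum>x\<in>p. - \<epsilon> * (Sup (snd x) - Inf (snd x)))"
      unfolding sum_distrib_left[symmetric]
      using additive_tagged_division_1[OF ab p(1), of "\<lambda>x. x"] by (simp add: case_prod_unfold)
    also have "\<dots> = (\<Sum>x\<in>P. - \<epsilon> * (Sup (snd x) - Inf (snd x))) + (\<Sum>x\<in>p - P. - \<epsilon> * (Sup (snd x) - Inf (snd x)))"
      by (rule split)
    also have "\<dots> \<le> 0 + (\<Sum>x\<in>p - P. ?g (snd x))"
    proof (intro add_mono sum_nonpos sum_mono)
      fix x assume "x \<in> P"
      then have "(fst x, snd x) \<in> p" by (simp add: P_def)
      from K[OF this] have "Inf (snd x) \<le> Sup (snd x)" by (metis order_trans)
      then show "- \<epsilon> * (Sup (snd x) - Inf (snd x)) \<le> 0"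
        using \<epsilon>(1) by (simp add: mult_nonneg_nonneg)
    next
      fix x assume x: "x \<in> p - P"
      then have xp: "(fst x, snd x) \<in> p" by simp
      note k = K[OF xp]
      then have "Inf (snd x) \<in> snd x" "Sup (snd x) \<in> snd x"
        by (metis atLeastAtMost_iff order_refl order_trans)+
      with k have "Inf (snd x) \<in> {a..b} \<inter> ball (fst x) (r (fst x))"
        "Sup (snd x) \<in> {a..b} \<inter> ball (fst x) (r (fst x))" by blast+
      moreover have "fst x \<in> {a..b} - N" using x tag_in_interval[OF p(1) xp] by (auto simp: P_def)
      ultimately show "- \<epsilon> * (Sup (snd x) - Inf (snd x)) \<le> ?g (snd x)"
        using k r(3) by blast
    qed
    finally show ?thesis by simp
  qed
  have "f b - f a = (\<Sum>x\<in>p. ?g (snd x))"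
    using additive_tagged_division_1[OF ab p(1), of f] by (simp add: case_prod_unfold)
  also have "\<dots> = (\<Sum>x\<in>P. ?g (snd x)) + (\<Sum>x\<in>p - P. ?g (snd x))"
    by (rule split)
  also have "\<dots> \<ge> - \<epsilon> * (b - a) - \<epsilon>"
    using sum1 sum2 sum_abs[of "\<lambda>x. ?g (snd x)" P] by linarith
  finally have "f b - f a \<ge> - (\<epsilon> * (1 + (b - a)))" by (simp add: algebra_simps)
  with \<epsilon> show "f a \<le> f b + \<epsilon>0" by simp
qed

section \<open>Filippov sets of fields with one sign discontinuity\<close>

text \<open>Near \<open>x\<close> the open set \<open>U\<close> contains nonempty open pieces, and
  no null set can swallow such a piece. The limit of \<open>f\<close> along \<open>U\<close>
  therefore survives every choice of the discarded set.\<close>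

lemma filippov_set_limit_memI:
  fixes f c :: "'a::euclidean_space \<Rightarrow> 'a"
  assumes c: "isCont c x" and U: "open U" "x \<in> closure U" and eq: "\<And>z. z \<in> U \<Longrightarrow> f z = c z"
  shows "c x \<in> filippov_set f x"
  unfolding filippov_set_def
proof (intro INT_I)
  fix \<delta> :: real and N :: "'a set"
  assume "\<delta> \<in> {0<..}" and "N \<in> {N. negligible N}"
  then have \<delta>: "\<delta> > 0" and N: "negligible N" by auto
  have "c x \<in> closure (f ` (ball x \<delta> - N))"
    unfolding closure_approachable
  proof (intro allI impI)
    fix e :: real assume "e > 0"
    with c obtain d where d: "d > 0" "\<And>z. dist z x < d \<Longrightarrow> dist (c z) (c x) < e"
      unfolding continuous_at_eps_delta by metis
    define V where "V = U \<inter> ball x (min d \<delta>)"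
    have "open V" using U by (auto simp: V_def)
    moreover have "V \<noteq> {}"
    proof -
      have "min d \<delta> > 0" using d \<delta> by simp
      with U(2) obtain z where "z \<in> U" "dist z x < min d \<delta>"
        unfolding closure_approachable by blast
      then show ?thesis by (auto simp: V_def dist_commute)
    qed
    ultimately have "\<not> V \<subseteq> N"
      using negligible_subset[OF N, of V] open_not_negligible[of V] by blast
    then obtain z where z: "z \<in> V" "z \<notin> N" by blast
    then have "z \<in> ball x \<delta> - N" "dist (f z) (c x) < e"
      using d(2)[of z] eq[of z] by (auto simp: V_def dist_commute)
    then show "\<exists>y\<in>f ` (ball x \<delta> - N). dist y (c x) < e" by blast
  qed
  then show "c x \<in> closure (convex hull f ` (ball x \<delta> - N))"
    by (rule subsetD[OF closure_mono[OF hull_subset]])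
qed

lemma convex_filippov_set: "convex (filippov_set f x)"
  unfolding filippov_set_def by (intro convex_INT convex_closure convex_convex_hull)

text \<open>On a small ball \<open>f\<close> takes values in the sum of a small closed ball around
  \<open>c x\<close> and \<open>K\<close>. That sum is closed, as a sum of compact sets, and convex,
  so it contains the closed convex hull obtained with the empty null set; letting the ball shrink
  leaves \<open>c x + K\<close> because \<open>K\<close> is closed.\<close>

lemma filippov_set_subset_translate:
  fixes f c :: "'a::euclidean_space \<Rightarrow> 'a"
  assumes c: "isCont c x" and K: "compact K" "convex K"
    and r: "r > 0" "\<And>z. z \<in> ball x r \<Longrightarrow> f z - c z \<in> K"
    and v: "v \<in> filippov_set f x"
  shows "v - c x \<in> K"
proof -
  have "\<exists>k\<in>K. dist k (v - c x) < e" if "e > 0" for e :: real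
  proof -
    from that have "e / 2 > 0" by simp
    with c obtain d where d: "d > 0" "\<And>z. dist z x < d \<Longrightarrow> dist (c z) (c x) < e / 2"
      unfolding continuous_at_eps_delta by metis
    define S where "S = (\<Union>a\<in>cball (c x) (e / 2). \<Union>b\<in>K. {a + b})"
    have "compact S"
      unfolding S_def by (rule compact_sums'[OF compact_cball K(1)])
    then have S: "closed S" "convex S"
      unfolding S_def by (auto intro: compact_imp_closed convex_sums[OF convex_cball K(2)])
    have "f ` (ball x (min d r) - {}) \<subseteq> S"
    proof
      fix w assume "w \<in> f ` (ball x (min d r) - {})"
      then obtain z where z: "w = f z" "z \<in> ball x (min d r)" by blast
      then have "c z \<in> cball (c x) (e / 2)" "f z - c z \<in> K"
        using d(2)[of z] r(2)[of z] by (auto simp: dist_commute)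
      moreover have "w = c z + (f z - c z)" using z by simp
      ultimately show "w \<in> S" unfolding S_def by blast
    qed
    then have "closure (convex hull (f ` (ball x (min d r) - {}))) \<subseteq> S"
      using S by (intro closure_minimal hull_minimal) auto
    moreover have "min d r \<in> {0<..}" "{} \<in> {N :: 'a set. negligible N}" using d r by auto
    then have "v \<in> closure (convex hull (f ` (ball x (min d r) - {})))"
      using v unfolding filippov_set_def by (meson INT_D)
    ultimately have "v \<in> S" by blast
    then obtain a b where "dist (c x) a \<le> e / 2" "b \<in> K" "v = a + b"
      unfolding S_def by auto
    then have "dist b (v - c x) < e" using that by (simp add: dist_norm norm_minus_commute algebra_simps)
    with \<open>b \<in> K\<close> show ?thesis by blast
  qed
  then show ?thesis using closed_approachable[OF compact_imp_closed[OF K(1)]] by blast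
qed

text \<open>Filippov's regularisation of \<open>sgn\<close>: at the jump all convex combinations of
  the two one-sided limits are allowed.\<close>

definition sign_set :: "real \<Rightarrow> real set" where
  "sign_set x = (if x = 0 then {-1..1} else {sgn x})"

lemma sign_set_abs_le: "s \<in> sign_set x \<Longrightarrow> \<bar>s\<bar> \<le> 1"
  by (auto simp: sign_set_def sgn_if split: if_splits)

text \<open>The upper inclusion treats the sign term as the bounded remainder of a continuous field.
  The lower one takes the limits from the two sides of the switching line and joins them by
  convexity.\<close>

lemma filippov_set_sign_feedback_aux:
  fixes c :: "real \<times> real \<Rightarrow> real \<times> real"
  assumes c: "isCont c x"
  shows "filippov_set (\<lambda>z. c z + (0, - (k * sgn (fst z - a)))) x
    = (\<lambda>s. c x + (0, - (k * s))) ` sign_set (fst x - a)" (is "filippov_set ?f x = _")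
proof -
  define K :: "real \<Rightarrow> (real \<times> real) set" where "K d = (\<lambda>s. (0, - (k * s))) ` sign_set d" for d
  have im: "K d = (\<lambda>s. s *\<^sub>R (0, - k)) ` sign_set d" for d
    by (auto simp: K_def mult.commute)
  have "compact (sign_set d)" "convex (sign_set d)" for d
    by (simp_all add: sign_set_def)
  then have K: "compact (K d)" "convex (K d)" for d
    unfolding im by (intro compact_continuous_image continuous_intros convex_linear_image
        bounded_linear.linear[OF bounded_linear_scaleR_left]; simp)+
  have lim: "c x + (0, - (k * s)) \<in> filippov_set ?f x"
    if U: "open U" "x \<in> closure U" "\<And>z. z \<in> U \<Longrightarrow> sgn (fst z - a) = s" for U s
  proof -
    have "isCont (\<lambda>z. c z + (0, - (k * s))) x" using c by (intro continuous_intros)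
    from filippov_set_limit_memI[OF this U(1,2), of ?f] U(3) show ?thesis by simp
  qed
  have open_gt: "open {z :: real \<times> real. fst z > a}" and open_lt: "open {z :: real \<times> real. fst z < a}"
    by (auto intro!: open_Collect_less continuous_intros)
  show ?thesis
  proof (intro equalityI subsetI)
    fix v assume v: "v \<in> filippov_set ?f x"
    have "\<exists>r>0. \<forall>z\<in>ball x r. ?f z - c z \<in> K (fst x - a)"
    proof (cases "fst x = a")
      case True
      then have "?f z - c z \<in> K (fst x - a)" for z
        unfolding K_def by (intro image_eqI[of _ _ "sgn (fst z - a)"]) (auto simp: sign_set_def sgn_if)
      then show ?thesis by (intro exI[of _ 1]) auto
    next
      case False
      \<comment> \<open>A ball of this radius does not meet the switching line.\<close>
      have "sgn (fst z - a) = sgn (fst x - a)" if "z \<in> ball x \<bar>fst x - a\<bar>" for z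
      proof -
        have "\<bar>fst x - fst z\<bar> < \<bar>fst x - a\<bar>"
          using that dist_fst_le[of x z] by (simp add: dist_real_def)
        then have "fst z > a \<and> fst x > a \<or> fst z < a \<and> fst x < a" using False by argo
        then show ?thesis by (elim disjE conjE) simp_all
      qed
      note sgn_eq = this
      have "?f z - c z \<in> K (fst x - a)" if "z \<in> ball x \<bar>fst x - a\<bar>" for z
        unfolding sgn_eq[OF that] using False by (simp add: K_def sign_set_def)
      with False show ?thesis by (intro exI[of _ "\<bar>fst x - a\<bar>"]) simp
    qed
    then obtain r where "r > 0" "\<And>z. z \<in> ball x r \<Longrightarrow> ?f z - c z \<in> K (fst x - a)" by blast
    from filippov_set_subset_translate[OF c K this v]
    obtain s where "v - c x = (0, - (k * s))" "s \<in> sign_set (fst x - a)" by (auto simp: K_def)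
    then show "v \<in> (\<lambda>s. c x + (0, - (k * s))) ` sign_set (fst x - a)"
      by (intro image_eqI[of _ _ s]) (auto simp: algebra_simps)
  next
    fix v assume "v \<in> (\<lambda>s. c x + (0, - (k * s))) ` sign_set (fst x - a)"
    then obtain s where s: "v = c x + (0, - (k * s))" "s \<in> sign_set (fst x - a)" by blast
    consider "fst x > a" | "fst x < a" | "fst x = a" by linarith
    then show "v \<in> filippov_set ?f x"
    proof cases
      case 1
      then have "x \<in> closure {z. fst z > a}" by (intro subsetD[OF closure_subset]) simp
      moreover have "s = 1" using s(2) 1 by (simp add: sign_set_def)
      ultimately show ?thesis unfolding s(1) by (intro lim[OF open_gt]) auto
    next
      case 2
      then have "x \<in> closure {z. fst z < a}" by (intro subsetD[OF closure_subset]) simp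
      moreover have "s = - 1" using s(2) 2 by (simp add: sign_set_def)
      ultimately show ?thesis unfolding s(1) by (intro lim[OF open_lt]) auto
    next
      case 3
      have cl: "x \<in> closure {z. fst z > a}" "x \<in> closure {z. fst z < a}"
      proof -
        have "fst (x + (e / 2, 0)) > a" "dist (x + (e / 2, 0)) x < e"
          "fst (x - (e / 2, 0)) < a" "dist (x - (e / 2, 0)) x < e" if "e > 0" for e
          using 3 that by (simp_all add: dist_norm norm_Pair)
        then show "x \<in> closure {z. fst z > a}" "x \<in> closure {z. fst z < a}"
          unfolding closure_approachable by blast+
      qed
      have p: "c x + (0, - (k * 1)) \<in> filippov_set ?f x"
        by (rule lim[OF open_gt cl(1)]) simp
      have m: "c x + (0, - (k * (-1))) \<in> filippov_set ?f x"
        by (rule lim[OF open_lt cl(2)]) simp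
      have s1: "-1 \<le> s" "s \<le> 1" using s 3 by (auto simp: sign_set_def)
      \<comment> \<open>The weights add up to \<open>1\<close> and differ by
        \<open>s\<close>.\<close>
      have "v = ((1 + s) / 2) *\<^sub>R (c x + (0, - (k * 1))) + ((1 - s) / 2) *\<^sub>R (c x + (0, - (k * (-1))))"
        unfolding s(1) by (simp add: prod_eq_iff field_simps)
      then show ?thesis
        using convexD[OF convex_filippov_set p m, of "(1 + s) / 2" "(1 - s) / 2"] s1
        by (simp add: field_simps)
    qed
  qed
qed

text \<open>The parameters \<open>a\<close> and \<open>d\<close> let one computation serve both
  kinds of system: the error systems switch at \<open>a = 0\<close> with \<open>d\<close> the second
  derivative of the signal, the differentiator switches at \<open>a = y t\<close> with
  \<open>d = 0\<close>.\<close>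

lemma filippov_set_sign_feedback:
  fixes h1 c :: "real \<Rightarrow> real"
  assumes "continuous_on UNIV h1" "continuous_on UNIV c"
    and h2: "\<And>w. h2 w = c w + k * sgn w"
  shows "filippov_set (\<lambda>(x1, x2). (- h1 (x1 - a) + x2, - h2 (x1 - a) - d)) x
    = (\<lambda>s. (- h1 (fst x - a) + snd x, - (c (fst x - a) + k * s) - d)) ` sign_set (fst x - a)"
proof -
  let ?c = "\<lambda>z::real \<times> real. (- h1 (fst z - a) + snd z, - c (fst z - a) - d)"
  have "continuous_on UNIV (\<lambda>z::real \<times> real. h1 (fst z - a))" "continuous_on UNIV (\<lambda>z::real \<times> real. c (fst z - a))"
    by (rule continuous_on_compose2[OF assms(1)] continuous_on_compose2[OF assms(2)];
        intro continuous_intros subset_UNIV)+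
  then have "continuous_on UNIV ?c" by (intro continuous_intros)
  then have "isCont ?c x" using continuous_on_eq_continuous_at[OF open_UNIV] by blast
  note filippov_set_sign_feedback_aux[OF this, of k a]
  moreover have "?c x + (0, - (k * s)) = (- h1 (fst x - a) + snd x, - (c (fst x - a) + k * s) - d)" for s
    by simp
  moreover have "(\<lambda>z. ?c z + (0, - (k * sgn (fst z - a))))
      = (\<lambda>(x1, x2). (- h1 (x1 - a) + x2, - h2 (x1 - a) - d))"
    by (auto simp: h2 fun_eq_iff)
  ultimately show ?thesis by (simp only:)
qed

section \<open>Signals and solutions under restriction to a later initial time\<close>

lemma at_within_Ici_neq_bot:
  fixes t t0 :: real
  assumes "t0 \<le> t"
  shows "at t within {t0..} \<noteq> bot"
proof -
  have "at t within {t..} \<le> at t within {t0..}" using assms by (intro at_le) auto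
  then show ?thesis
    using trivial_limit_at_right_real[of t] by (metis at_within_Ici_at_right bot.extremum_uniqueI)
qed

lemma at_within_Icc_eq_Ici:
  fixes t a b :: real
  assumes "t < b"
  shows "at t within {a..b} = at t within {a..}"
  by (rule at_within_nhd[of t "{..<b}"]) (use assms in auto)

lemma time_deriv_eqI:
  "(y has_vector_derivative v) (at t within {t0..}) \<Longrightarrow> t0 \<le> t \<Longrightarrow> time_deriv t0 y t = v"
  unfolding time_deriv_def by (intro vector_derivative_within at_within_Ici_neq_bot)

lemma has_vector_derivative_time_deriv:
  "y differentiable (at t within {t0..}) \<Longrightarrow>
    (y has_vector_derivative time_deriv t0 y t) (at t within {t0..})"
  unfolding time_deriv_def by (simp add: vector_derivative_works)

lemma has_vector_derivative_restrict_Ici: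
  fixes t t0 t1 :: real
  assumes "(f has_vector_derivative v) (at t within {t0..})" "t0 \<le> t1" "t1 \<le> t"
    and "\<And>s. t1 \<le> s \<Longrightarrow> f' s = f s"
  shows "(f' has_vector_derivative v) (at t within {t1..})"
  by (rule has_vector_derivative_transform[OF _ _ has_vector_derivative_within_subset[OF assms(1)]])
    (use assms in auto)

lemma admissible_signalsD:
  assumes "y \<in> admissible_signals L t0"
  shows "t0 \<le> t \<Longrightarrow> (y has_vector_derivative time_deriv t0 y t) (at t within {t0..})"
    and "\<exists>C. C-lipschitz_on {t0..} (time_deriv t0 y)"
    and "AE t in lebesgue. t0 \<le> t \<longrightarrow>
      (time_deriv t0 y has_vector_derivative time_deriv t0 (time_deriv t0 y) t) (at t within {t0..}) \<and>
      \<bar>time_deriv t0 (time_deriv t0 y) t\<bar> \<le> L (t - t0)"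
proof -
  show "t0 \<le> t \<Longrightarrow> (y has_vector_derivative time_deriv t0 y t) (at t within {t0..})"
    using assms by (auto simp: admissible_signals_def intro: has_vector_derivative_time_deriv)
  show "\<exists>C. C-lipschitz_on {t0..} (time_deriv t0 y)"
    using assms by (simp add: admissible_signals_def)
  have "AE t in lebesgue. t0 \<le> t \<longrightarrow> time_deriv t0 y differentiable (at t within {t0..}) \<and>
      \<bar>time_deriv t0 (time_deriv t0 y) t\<bar> \<le> L (t - t0)"
    using assms by (simp add: admissible_signals_def)
  then show "AE t in lebesgue. t0 \<le> t \<longrightarrow>
      (time_deriv t0 y has_vector_derivative time_deriv t0 (time_deriv t0 y) t) (at t within {t0..}) \<and>
      \<bar>time_deriv t0 (time_deriv t0 y) t\<bar> \<le> L (t - t0)"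
    by eventually_elim (auto intro: has_vector_derivative_time_deriv)
qed

text \<open>Stability is available only from the initial time of a system, so a restart must present
  the same signal with its bound rewritten in the new elapsed time. The second derivatives are
  compared where they are known to exist, hence almost everywhere.\<close>

lemma admissible_signals_restrict:
  assumes y: "y \<in> admissible_signals L t0" and t1: "t0 \<le> t1"
  shows "y \<in> admissible_signals (\<lambda>s. L (s + (t1 - t0))) t1"
    and "AE t in lebesgue. t1 \<le> t \<longrightarrow>
      time_deriv t1 (time_deriv t1 y) t = time_deriv t0 (time_deriv t0 y) t"
proof -
  have d1: "(y has_vector_derivative time_deriv t0 y t) (at t within {t1..})" if "t1 \<le> t" for t
    using has_vector_derivative_restrict_Ici[OF admissible_signalsD(1)[OF y], of t t1 y] that t1 by simp
  then have e1: "time_deriv t1 y t = time_deriv t0 y t" if "t1 \<le> t" for t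
    using that by (intro time_deriv_eqI)
  obtain C where C: "C-lipschitz_on {t0..} (time_deriv t0 y)" using admissible_signalsD(2)[OF y] by blast
  then have "C-lipschitz_on {t1..} (time_deriv t0 y)" by (rule lipschitz_on_subset) (use t1 in auto)
  then have lip: "C-lipschitz_on {t1..} (time_deriv t1 y)"
    by (rule lipschitz_on_transform) (use e1 in auto)
  have ae: "AE t in lebesgue. t1 \<le> t \<longrightarrow>
     (time_deriv t1 y has_vector_derivative time_deriv t0 (time_deriv t0 y) t) (at t within {t1..}) \<and>
      \<bar>time_deriv t0 (time_deriv t0 y) t\<bar> \<le> L (t - t0)"
    using admissible_signalsD(3)[OF y]
  proof eventually_elim
    case (elim t)
    show ?case
    proof
      assume t: "t1 \<le> t"
      with elim t1 have "(time_deriv t0 y has_vector_derivative time_deriv t0 (time_deriv t0 y) t) (at t within {t0..})"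
        and b: "\<bar>time_deriv t0 (time_deriv t0 y) t\<bar> \<le> L (t - t0)" by auto
      from has_vector_derivative_restrict_Ici[OF this(1) t1 t e1] b
      show "(time_deriv t1 y has_vector_derivative time_deriv t0 (time_deriv t0 y) t) (at t within {t1..}) \<and>
        \<bar>time_deriv t0 (time_deriv t0 y) t\<bar> \<le> L (t - t0)" by blast
    qed
  qed
  then show ae2: "AE t in lebesgue. t1 \<le> t \<longrightarrow>
      time_deriv t1 (time_deriv t1 y) t = time_deriv t0 (time_deriv t0 y) t"
    by eventually_elim (auto intro: time_deriv_eqI)
  have "AE t in lebesgue. t1 \<le> t \<longrightarrow> time_deriv t1 y differentiable (at t within {t1..}) \<and>
      \<bar>time_deriv t1 (time_deriv t1 y) t\<bar> \<le> L (t - t1 + (t1 - t0))"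
    using ae ae2
  proof eventually_elim
    case (elim t)
    then show ?case using differentiableI_vector by fastforce
  qed
  moreover have "y differentiable (at t within {t1..})" if "t1 \<le> t" for t
    using d1[OF that] by (rule differentiableI_vector)
  ultimately show "y \<in> admissible_signals (\<lambda>s. L (s + (t1 - t0))) t1"
    using lip unfolding admissible_signals_def by auto
qed

lemma positive_log_rate_le_shift:
  assumes L: "positive_log_rate_le L M" and c: "0 \<le> c"
  shows "positive_log_rate_le (\<lambda>s. L (s + c)) M"
  unfolding positive_log_rate_le_def
proof (intro allI impI)
  fix s :: real assume s: "0 \<le> s"
  have Ls: "0 < L (s + c)" "L differentiable (at (s + c) within {0..})"
    "(1 / L (s + c)) * \<bar>time_deriv 0 L (s + c)\<bar> \<le> M"
    using L s c unfolding positive_log_rate_le_def by auto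
  have "(L has_vector_derivative time_deriv 0 L (s + c)) (at (s + c) within (\<lambda>s. s + c) ` {0..})"
    by (rule has_vector_derivative_within_subset[OF has_vector_derivative_time_deriv[OF Ls(2)]])
      (use c in auto)
  moreover have "((\<lambda>s. s + c) has_vector_derivative 1) (at s within {0..})"
    by (auto intro!: derivative_eq_intros)
  ultimately have "((\<lambda>s. L (s + c)) has_vector_derivative time_deriv 0 L (s + c)) (at s within {0..})"
    using vector_diff_chain_within[of "\<lambda>s. s + c" 1 s "{0..}" L] by (simp add: o_def)
  with Ls show "0 < L (s + c) \<and> (\<lambda>s. L (s + c)) differentiable at s within {0..} \<and>
      1 / L (s + c) * \<bar>time_deriv 0 (\<lambda>s. L (s + c)) s\<bar> \<le> M"
    using time_deriv_eqI[OF _ s] by (auto intro: differentiableI_vector)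
qed

lemma filippov_solutionD:
  assumes "filippov_solution F t0 x"
  shows "t0 \<le> b \<Longrightarrow> abs_continuous_on {t0..b} x"
    and "AE t in lebesgue. t0 \<le> t \<longrightarrow>
      (\<exists>v \<in> filippov_set (F t) (x t). (x has_vector_derivative v) (at t within {t0..}))"
  using assms unfolding filippov_solution_def by auto

lemma filippov_solution_continuous_on:
  assumes "filippov_solution F t0 x"
  shows "continuous_on {t0..} x"
  unfolding continuous_on_eq_continuous_within
proof
  fix t assume "t \<in> {t0..}"
  then have "continuous_on {t0..t + 1} x"
    using filippov_solutionD(1)[OF assms, of "t + 1"] by (auto intro: abs_continuous_on_imp_continuous_on)
  then have "continuous (at t within {t0..t + 1}) x"
    using \<open>t \<in> {t0..}\<close> by (auto simp: continuous_on_eq_continuous_within)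
  then show "continuous (at t within {t0..}) x"
    by (simp add: at_within_Icc_eq_Ici)
qed

lemma filippov_solution_tendsto:
  "filippov_solution F t0 x \<Longrightarrow> t0 \<le> t \<Longrightarrow> (x \<longlongrightarrow> x t) (at t within {t0..})"
  using filippov_solution_continuous_on[of F t0 x] by (auto simp: continuous_on_def)

text \<open>Besides moving the initial time, this exchanges the right-hand side for one that agrees
  with it from \<open>t1\<close> on outside a null set of times. Both the restart with a shifted
  bound and the switch of formulas at \<open>t0 + Tc\<close> rest on it.\<close>

lemma filippov_solution_restrict:
  assumes sol: "filippov_solution F t0 x" and t1: "t0 \<le> t1"
    and F: "AE t in lebesgue. t1 \<le> t \<longrightarrow> F' t = F t"
  shows "filippov_solution F' t1 x"
  unfolding filippov_solution_def
proof (intro conjI allI impI)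
  fix b assume "t1 \<le> b"
  then have "abs_continuous_on {t0..b} x" using filippov_solutionD(1)[OF sol] t1 by simp
  then show "abs_continuous_on {t1..b} x" by (rule abs_continuous_on_subset) (use t1 in auto)
next
  show "AE t in lebesgue. t1 \<le> t \<longrightarrow>
      (\<exists>v \<in> filippov_set (F' t) (x t). (x has_vector_derivative v) (at t within {t1..}))"
    using filippov_solutionD(2)[OF sol] F
  proof eventually_elim
    case (elim t)
    show ?case
    proof
      assume t: "t1 \<le> t"
      with elim t1 obtain v where "v \<in> filippov_set (F' t) (x t)" "(x has_vector_derivative v) (at t within {t0..})"
        by auto
      then show "\<exists>v \<in> filippov_set (F' t) (x t). (x has_vector_derivative v) (at t within {t1..})"
        using has_vector_derivative_restrict_Ici[OF _ t1 t] by blast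
    qed
  qed
qed

section \<open>The Levant--Livne system\<close>

text \<open>The function \<open>sqrt\<close> is odd on the reals, so it already is the signed root,
  and its continuity can be used directly.\<close>

lemma signed_power_half: "signed_power w (1/2) = sqrt w"
  unfolding signed_power_def
  by (cases w "0 :: real" rule: linorder_cases) (simp_all add: powr_half_sqrt real_sqrt_minus)

text \<open>In \<open>phi2_sel\<close> the discontinuous factor \<open>sgn w\<close> is replaced by a free value \<open>s\<close>.\<close>

definition phi2_sel :: "gains \<Rightarrow> real \<Rightarrow> real \<Rightarrow> real \<Rightarrow> real \<Rightarrow> real" where
  "phi2_sel g M l s w =
     lambda0 g * l * s + lambda1 g * mu0 g * sqrt l * M * sqrt w + mu0 g * mu1 g * M\<^sup>2 * w"

lemma phi2_eq_sel: "phi2 g M l w = phi2_sel g M l 0 w + lambda0 g * l * sgn w"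
  by (simp add: phi2_def phi2_sel_def signed_power_half)

lemma continuous_on_phi1: "continuous_on S (phi1 g M l)"
proof -
  have "phi1 g M l = (\<lambda>w. lambda1 g * sqrt l * sqrt w + mu1 g * M * w)"
    by (simp add: fun_eq_iff phi1_def signed_power_half)
  then show ?thesis by (auto intro!: continuous_intros)
qed

lemma continuous_on_phi2_sel: "continuous_on S (phi2_sel g M l s)"
  unfolding phi2_sel_def by (intro continuous_intros)

lemma filippov_set_phi_error_system:
  "filippov_set (phi_error_system g L M t0 y t) x =
    (\<lambda>s. (- phi1 g M (L (t - t0)) (fst x) + snd x,
          - phi2_sel g M (L (t - t0)) s (fst x) - time_deriv t0 (time_deriv t0 y) t)) ` sign_set (fst x)"
proof -
  have "phi2_sel g M (L (t - t0)) 0 w + lambda0 g * L (t - t0) * s = phi2_sel g M (L (t - t0)) s w" for s w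
    by (simp add: phi2_sel_def)
  with filippov_set_sign_feedback[OF continuous_on_phi1 continuous_on_phi2_sel phi2_eq_sel,
      of g M "L (t - t0)" 0 g M "L (t - t0)" "time_deriv t0 (time_deriv t0 y) t" x]
  show ?thesis by (simp add: phi_error_system_def error_system_def)
qed

text \<open>Without a common instant the infimum would range over the empty set and the settling
  time would be infinite.\<close>

lemma finite_time_stable_common_settling:
  assumes "finite_time_stable Y F" "0 \<le> t0"
  shows "\<exists>\<xi>\<ge>t0. \<forall>y\<in>Y t0. \<forall>e. filippov_solution (F t0 y) t0 e \<and> e t0 = e0 \<longrightarrow>
           (e \<longlongrightarrow> 0) (at \<xi> within {t0..})"
proof (rule ccontr)
  assume "\<not> ?thesis"
  then have "{ereal \<xi> | \<xi>. t0 \<le> \<xi> \<and> (\<forall>y\<in>Y t0. \<forall>e. filippov_solution (F t0 y) t0 e \<and> e t0 = e0 \<longrightarrow>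
           (e \<longlongrightarrow> 0) (at \<xi> within {t0..}))} = {}" by blast
  then have "settling_time Y F e0 t0 = \<infinity>"
    unfolding settling_time_def by (simp only: Inf_empty) (simp add: top_ereal_def)
  then show False using assms unfolding finite_time_stable_def by (metis less_irrefl)
qed

text \<open>A zero initial state lies in every \<open>\<delta>\<close>-ball, so stability bounds the
  solution by every positive \<open>\<epsilon>\<close>. To have \<open>t1\<close> as an initial
  state, the system is restarted there with the shifted bound.\<close>

lemma phi_error_system_stays_zero:
  assumes g: "suitable_gains g" and L: "positive_log_rate_le L M"
    and t0: "0 \<le> t0" "t0 \<le> t1" "t1 \<le> t" and y: "y \<in> admissible_signals L t0"
    and sol: "filippov_solution (phi_error_system g L M t0 y) t1 e" and zero: "e t1 = 0"
  shows "e t = 0"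
proof -
  define L' where "L' = (\<lambda>s. L (s + (t1 - t0)))"
  have y': "y \<in> admissible_signals L' t1"
    unfolding L'_def by (rule admissible_signals_restrict(1)[OF y t0(2)])
  have "AE t in lebesgue. t1 \<le> t \<longrightarrow> phi_error_system g L' M t1 y t = phi_error_system g L M t0 y t"
    using admissible_signals_restrict(2)[OF y t0(2)]
    by eventually_elim (simp add: phi_error_system_def error_system_def L'_def)
  then have "filippov_solution (phi_error_system g L' M t1 y) t1 e"
    by (rule filippov_solution_restrict[OF sol order_refl])
  moreover have "positive_log_rate_le L' M"
    unfolding L'_def using L t0 by (intro positive_log_rate_le_shift) auto
  then have "finite_time_stable (admissible_signals L') (phi_error_system g L' M)"
    using g by (simp add: suitable_gains_def)
  then have "globally_asymptotically_stable (phi_error_system g L' M t1 y) t1"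
    using y' t0 unfolding finite_time_stable_def by auto
  ultimately have "norm (e t) < \<epsilon>" if "\<epsilon> > 0" for \<epsilon>
    using that zero t0(3) unfolding globally_asymptotically_stable_def by (metis norm_zero)
  then show ?thesis by (metis less_irrefl zero_less_norm_iff)
qed

text \<open>The settling instant supplies a limit, which continuity of the solution turns into the
  value zero; from there zero persists.\<close>

lemma phi_error_system_settles:
  assumes g: "suitable_gains g" and L: "positive_log_rate_le L M"
    and t0: "0 \<le> t0" and y: "y \<in> admissible_signals L t0"
    and sol: "filippov_solution (phi_error_system g L M t0 y) t0 e"
  obtains \<xi> where "t0 \<le> \<xi>" "\<And>t. \<xi> \<le> t \<Longrightarrow> e t = 0"
proof -
  have "finite_time_stable (admissible_signals L) (phi_error_system g L M)"
    using g L by (simp add: suitable_gains_def)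
  from finite_time_stable_common_settling[OF this t0, of "e t0"] y sol
  obtain \<xi> where \<xi>: "t0 \<le> \<xi>" "(e \<longlongrightarrow> 0) (at \<xi> within {t0..})" by blast
  then have "e \<xi> = 0"
    using tendsto_unique[OF at_within_Ici_neq_bot filippov_solution_tendsto[OF sol]] by blast
  moreover have "filippov_solution (phi_error_system g L M t0 y) \<xi> e"
    by (rule filippov_solution_restrict[OF sol \<xi>(1)]) simp
  ultimately show ?thesis
    using that[OF \<xi>(1)] phi_error_system_stays_zero[OF g L t0 \<xi>(1) _ y] by blast
qed

section \<open>The change of time scale\<close>

lemma lipschitz_on_mult_bounded:
  fixes f g :: "real \<Rightarrow> real"
  assumes f: "C-lipschitz_on S f" "\<And>t. t \<in> S \<Longrightarrow> \<bar>f t\<bar> \<le> A"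
    and g: "D-lipschitz_on S g" "\<And>t. t \<in> S \<Longrightarrow> \<bar>g t\<bar> \<le> B"
    and "0 \<le> A" "0 \<le> B"
  shows "(C * B + A * D)-lipschitz_on S (\<lambda>t. f t * g t)"
proof (rule lipschitz_onI)
  fix u v assume u: "u \<in> S" and v: "v \<in> S"
  have "f u * g u - f v * g v = (f u - f v) * g u + f v * (g u - g v)" by (simp add: algebra_simps)
  then have "\<bar>f u * g u - f v * g v\<bar> \<le> \<bar>f u - f v\<bar> * \<bar>g u\<bar> + \<bar>f v\<bar> * \<bar>g u - g v\<bar>"
    by (metis abs_triangle_ineq abs_mult)
  also have "\<dots> \<le> (C * \<bar>u - v\<bar>) * B + A * (D * \<bar>u - v\<bar>)"
    using lipschitz_onD[OF f(1) u v] lipschitz_onD[OF g(1) u v] f(2)[OF v] g(2)[OF u] assms(5,6)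
      lipschitz_on_nonneg[OF f(1)] lipschitz_on_nonneg[OF g(1)]
    by (intro add_mono mult_mono) (auto simp: dist_real_def)
  finally show "dist (f u * g u) (f v * g v) \<le> (C * B + A * D) * dist u v"
    by (simp add: dist_real_def algebra_simps)
qed (use assms lipschitz_on_nonneg[OF f(1)] lipschitz_on_nonneg[OF g(1)] in auto)

lemma lipschitz_on_has_real_derivative:
  fixes f :: "real \<Rightarrow> real"
  assumes "convex S" "0 \<le> C"
    and "\<And>t. t \<in> S \<Longrightarrow> (f has_vector_derivative f' t) (at t within S)" "\<And>t. t \<in> S \<Longrightarrow> \<bar>f' t\<bar> \<le> C"
  shows "C-lipschitz_on S f"
proof (rule lipschitz_onI)
  fix u v assume "u \<in> S" "v \<in> S"
  have "norm (f u - f v) \<le> C * norm (u - v)"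
    by (rule field_differentiable_bound[OF assms(1) _ _ \<open>u \<in> S\<close> \<open>v \<in> S\<close>, of f f'])
      (use assms in \<open>auto simp: has_real_derivative_iff_has_vector_derivative\<close>)
  then show "dist (f u) (f v) \<le> C * dist u v" by (simp add: dist_norm)
qed (rule assms)

lemma admissible_signals_lipschitz_on:
  assumes y: "y \<in> admissible_signals L t0"
  obtains C where "C-lipschitz_on {t0..b} y" "\<And>t. t \<in> {t0..b} \<Longrightarrow> \<bar>y t\<bar> \<le> C"
    "\<And>t. t \<in> {t0..b} \<Longrightarrow> \<bar>time_deriv t0 y t\<bar> \<le> C" "C-lipschitz_on {t0..} (time_deriv t0 y)"
proof -
  obtain D where D: "D-lipschitz_on {t0..} (time_deriv t0 y)" using admissible_signalsD(2)[OF y] by blast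
  have d: "(y has_vector_derivative time_deriv t0 y t) (at t within {t0..b})" if "t \<in> {t0..b}" for t
    using that by (intro has_vector_derivative_within_subset[OF admissible_signalsD(1)[OF y]]) auto
  have "continuous_on {t0..b} y"
    using d by (meson continuous_on_vector_derivative)
  moreover have "continuous_on {t0..b} (time_deriv t0 y)"
    using lipschitz_on_continuous_on[OF D] by (rule continuous_on_subset) auto
  ultimately have "bounded (y ` {t0..b})" "bounded (time_deriv t0 y ` {t0..b})"
    by (simp_all add: compact_imp_bounded compact_continuous_image)
  then have "\<exists>A. \<forall>t\<in>{t0..b}. \<bar>y t\<bar> \<le> A" "\<exists>B. \<forall>t\<in>{t0..b}. \<bar>time_deriv t0 y t\<bar> \<le> B"
    unfolding bounded_iff by auto
  then obtain A B where AB: "\<And>t. t \<in> {t0..b} \<Longrightarrow> \<bar>y t\<bar> \<le> A" "\<And>t. t \<in> {t0..b} \<Longrightarrow> \<bar>time_deriv t0 y t\<bar> \<le> B"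
    by metis
  define C where "C = max 0 (max A (max B D))"
  have C: "0 \<le> C" "A \<le> C" "B \<le> C" "D \<le> C" by (auto simp: C_def)
  show ?thesis
  proof (rule that[of C])
    show "\<bar>y t\<bar> \<le> C" "\<bar>time_deriv t0 y t\<bar> \<le> C" if "t \<in> {t0..b}" for t
      using AB[OF that] C by linarith+
    then show "C-lipschitz_on {t0..b} y"
      using d C by (intro lipschitz_on_has_real_derivative[of _ _ y "time_deriv t0 y"]) auto
    show "C-lipschitz_on {t0..} (time_deriv t0 y)" using D C by (auto intro: lipschitz_on_mono)
  qed
qed

section \<open>Filippov sets of the predefined-time system and of the differentiator\<close>

definition pt_h2_sel ::
    "gains \<Rightarrow> real \<Rightarrow> real \<Rightarrow> (real \<Rightarrow> real) \<Rightarrow> real \<Rightarrow> (real \<Rightarrow> real) \<Rightarrow> real \<Rightarrow>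
     real \<Rightarrow> real \<Rightarrow> real \<Rightarrow> real \<Rightarrow> real" where
  "pt_h2_sel g alpha Tc L M LL MM t0 s w t =
     (if t \<in> {t0..<t0 + Tc}
      then (kappa alpha Tc (t - t0))\<^sup>2 *
             (alpha\<^sup>2 * w + phi2_sel g MM (LL (time_map alpha Tc t0 t)) s w
                - alpha * phi1 g MM (LL (time_map alpha Tc t0 t)) w)
      else phi2_sel g M (L (t - t0)) s w)"

text \<open>The factor \<open>k\<close> is the gain of the sign term at the fixed instant
  \<open>t\<close>. Obtaining it abstractly hides the case distinction on \<open>t\<close> from the
  computation of the Filippov set.\<close>

lemma pt_h2_sel_affine:
  obtains k where
    "\<And>s w. pt_h2_sel g alpha Tc L M LL MM t0 s w t = pt_h2_sel g alpha Tc L M LL MM t0 0 w t + k * s"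
    "\<And>w. pt_h2 g alpha Tc L M LL MM t0 w t = pt_h2_sel g alpha Tc L M LL MM t0 0 w t + k * sgn w"
proof (cases "t \<in> {t0..<t0 + Tc}")
  case True
  then show ?thesis
    by (intro that[of "(kappa alpha Tc (t - t0))\<^sup>2 * (lambda0 g * LL (time_map alpha Tc t0 t))"])
      (simp_all only: pt_h2_def pt_h2_sel_def phi2_eq_sel if_P[OF True], simp_all add: phi2_sel_def algebra_simps)
next
  case False
  then show ?thesis
    by (intro that[of "lambda0 g * L (t - t0)"])
      (simp_all only: pt_h2_def pt_h2_sel_def phi2_eq_sel if_not_P[OF False], simp_all add: phi2_sel_def algebra_simps)
qed

lemma continuous_on_pt_h1: "continuous_on UNIV (\<lambda>w. pt_h1 g alpha Tc L M LL MM t0 w t)"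
  unfolding pt_h1_def by (cases "t \<in> {t0..<t0 + Tc}") (auto intro!: continuous_intros continuous_on_phi1)

lemma continuous_on_pt_h2_sel: "continuous_on UNIV (\<lambda>w. pt_h2_sel g alpha Tc L M LL MM t0 s w t)"
  unfolding pt_h2_sel_def
  by (cases "t \<in> {t0..<t0 + Tc}") (auto intro!: continuous_intros continuous_on_phi1 continuous_on_phi2_sel)

lemma filippov_set_pt:
  "filippov_set (\<lambda>(x1, x2). (- pt_h1 g alpha Tc L M LL MM t0 (x1 - a) t + x2,
       - pt_h2 g alpha Tc L M LL MM t0 (x1 - a) t - d)) x =
    (\<lambda>s. (- pt_h1 g alpha Tc L M LL MM t0 (fst x - a) t + snd x,
          - pt_h2_sel g alpha Tc L M LL MM t0 s (fst x - a) t - d)) ` sign_set (fst x - a)"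
proof -
  obtain k where k:
    "\<And>s w. pt_h2_sel g alpha Tc L M LL MM t0 s w t = pt_h2_sel g alpha Tc L M LL MM t0 0 w t + k * s"
    "\<And>w. pt_h2 g alpha Tc L M LL MM t0 w t = pt_h2_sel g alpha Tc L M LL MM t0 0 w t + k * sgn w"
    using pt_h2_sel_affine[where g = g and alpha = alpha and Tc = Tc and L = L and M = M and LL = LL
        and MM = MM and ?t0.0 = t0 and t = t] by blast
  show ?thesis
    unfolding filippov_set_sign_feedback[OF continuous_on_pt_h1 continuous_on_pt_h2_sel k(2)]
      k(1)[symmetric] ..
qed

lemma filippov_set_pt_error_system:
  "filippov_set (pt_error_system g alpha Tc L M LL MM t0 y t) x =
    (\<lambda>s. (- pt_h1 g alpha Tc L M LL MM t0 (fst x) t + snd x,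
          - pt_h2_sel g alpha Tc L M LL MM t0 s (fst x) t - time_deriv t0 (time_deriv t0 y) t))
      ` sign_set (fst x)"
  using filippov_set_pt[of g alpha Tc L M LL MM t0 0 t] by (simp add: pt_error_system_def error_system_def)

lemma filippov_set_differentiator:
  "filippov_set (differentiator (pt_h1 g alpha Tc L M LL MM t0) (pt_h2 g alpha Tc L M LL MM t0) y t) x =
    (\<lambda>s. (- pt_h1 g alpha Tc L M LL MM t0 (fst x - y t) t + snd x,
          - pt_h2_sel g alpha Tc L M LL MM t0 s (fst x - y t) t)) ` sign_set (fst x - y t)"
  using filippov_set_pt[of g alpha Tc L M LL MM t0 "y t" t 0] by (simp add: differentiator_def)

text \<open>The switching variable of the differentiator is the first error component, so the same
  selection \<open>s\<close> serves both inclusions; subtracting the first and second derivatives of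
  \<open>y\<close> from the velocity turns one set into the other.\<close>

lemma differentiator_error_solution:
  assumes y: "y \<in> admissible_signals L t0"
    and sol: "filippov_solution
      (differentiator (pt_h1 g alpha Tc L M LL MM t0) (pt_h2 g alpha Tc L M LL MM t0) y) t0 z"
  shows "filippov_solution (pt_error_system g alpha Tc L M LL MM t0 y) t0
    (\<lambda>t. z t - (y t, time_deriv t0 y t))"
  unfolding filippov_solution_def
proof (intro conjI allI impI)
  fix b assume b: "t0 \<le> b"
  obtain C where "C-lipschitz_on {t0..b} y" "C-lipschitz_on {t0..} (time_deriv t0 y)"
    using admissible_signals_lipschitz_on[OF y] by metis
  moreover from this(2) have "C-lipschitz_on {t0..b} (time_deriv t0 y)"
    by (rule lipschitz_on_subset) auto
  ultimately show "abs_continuous_on {t0..b} (\<lambda>t. z t - (y t, time_deriv t0 y t))"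
    by (intro abs_continuous_on_diff abs_continuous_on_Pair filippov_solutionD(1)[OF sol b]
        lipschitz_imp_abs_continuous_on)
next
  show "AE t in lebesgue. t0 \<le> t \<longrightarrow>
      (\<exists>v\<in>filippov_set (pt_error_system g alpha Tc L M LL MM t0 y t) (z t - (y t, time_deriv t0 y t)).
        ((\<lambda>t. z t - (y t, time_deriv t0 y t)) has_vector_derivative v) (at t within {t0..}))"
    using filippov_solutionD(2)[OF sol] admissible_signalsD(3)[OF y]
  proof eventually_elim
    case (elim t)
    show ?case
    proof
      assume t: "t0 \<le> t"
      let ?d2 = "time_deriv t0 (time_deriv t0 y) t"
      from elim t obtain s where s: "s \<in> sign_set (fst (z t) - y t)"
        and d: "(z has_vector_derivative (- pt_h1 g alpha Tc L M LL MM t0 (fst (z t) - y t) t + snd (z t),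
          - pt_h2_sel g alpha Tc L M LL MM t0 s (fst (z t) - y t) t)) (at t within {t0..})"
          (is "(z has_vector_derivative ?v) _")
        unfolding filippov_set_differentiator by auto
      have "((\<lambda>t. z t - (y t, time_deriv t0 y t)) has_vector_derivative ?v - (time_deriv t0 y t, ?d2))
          (at t within {t0..})"
        using elim t by (intro has_vector_derivative_diff d has_vector_derivative_Pair
            admissible_signalsD(1)[OF y]) auto
      moreover have "?v - (time_deriv t0 y t, ?d2)
          \<in> filippov_set (pt_error_system g alpha Tc L M LL MM t0 y t) (z t - (y t, time_deriv t0 y t))"
        unfolding filippov_set_pt_error_system using s by (intro image_eqI[of _ _ s]) simp_all
      ultimately show "\<exists>v\<in>filippov_set (pt_error_system g alpha Tc L M LL MM t0 y t) (z t - (y t, time_deriv t0 y t)).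
        ((\<lambda>t. z t - (y t, time_deriv t0 y t)) has_vector_derivative v) (at t within {t0..})" by blast
    qed
  qed
qed

section \<open>The substitution in time and state\<close>

text \<open>Here \<open>r\<close> stands for \<open>1 / kappa\<close> and \<open>v\<close> for the
  velocity of the error. The left sides are the \<open>\<tau>\<close>-derivatives of
  \<open>x1\<close> and of \<open>r * e2 + alpha * x1\<close>, the latter computed with
  \<open>r' = - alpha * r\<close>. The terms \<open>alpha\<^sup>2 * x1\<close> and
  \<open>- alpha * p1\<close> are exactly what the substitution produces with the opposite
  sign.\<close>

lemma time_change_algebra:
  fixes r alpha kap d x1 e2 p1 p2 :: real
  assumes "kap * r = 1"
    and v: "v = (- (kap * (- alpha * x1 + p1)) + e2, - (kap\<^sup>2 * (alpha\<^sup>2 * x1 + p2 - alpha * p1)) - d)"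
  shows "r * fst v = - p1 + (r * e2 + alpha * x1)"
    and "(- (alpha * r)) * e2 + r * (r * snd v) + alpha * (r * fst v) = - p2 - d * r\<^sup>2"
proof -
  have 1: "r * (kap * z) = z" for z using assms(1) by (metis mult.assoc mult.commute mult_1)
  show fst: "r * fst v = - p1 + (r * e2 + alpha * x1)"
    using 1[of "- alpha * x1 + p1"] unfolding v by (simp add: algebra_simps)
  have "r * (r * (kap\<^sup>2 * z)) = r * (kap * (r * (kap * z)))" for z
    by (simp add: power2_eq_square ac_simps)
  then have "r * (r * (kap\<^sup>2 * z)) = z" for z
    by (simp only: 1)
  from this[of "alpha\<^sup>2 * x1 + p2 - alpha * p1"]
  have "r * (r * snd v) = - (alpha\<^sup>2 * x1 + p2 - alpha * p1) - d * r\<^sup>2"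
    unfolding v by (simp add: algebra_simps power2_eq_square)
  then show "(- (alpha * r)) * e2 + r * (r * snd v) + alpha * (r * fst v) = - p2 - d * r\<^sup>2"
    unfolding fst by (simp add: algebra_simps power2_eq_square)
qed

locale time_scaling =
  fixes alpha Tc t0 :: real
  assumes Tc: "0 < Tc" and alpha: "0 < alpha"
begin

text \<open>The inverse of \<open>time_map\<close>, running over \<open>[t0, t0 + Tc)\<close> as
  \<open>\<tau>\<close> runs over the half-line.\<close>

definition clock :: "real \<Rightarrow> real" where "clock \<tau> = t0 + Tc * (1 - exp (- alpha * \<tau>))"
text \<open>The derivative of \<open>clock\<close>, and along it the reciprocal of
  \<open>kappa\<close>. It does not depend on \<open>t0\<close>.\<close>

definition clock_rate :: "real \<Rightarrow> real" where "clock_rate \<tau> = alpha * Tc * exp (- alpha * \<tau>)"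

lemma clock_rate_pos: "0 < clock_rate \<tau>"
  using Tc alpha by (simp add: clock_rate_def)

lemma clock_rate_le: "0 \<le> \<tau> \<Longrightarrow> clock_rate \<tau> \<le> alpha * Tc"
  using Tc alpha by (simp add: clock_rate_def mult_left_le)

lemma clock_bounds: "0 \<le> \<tau> \<Longrightarrow> clock \<tau> \<in> {t0..<t0 + Tc}"
  using Tc alpha by (simp add: clock_def)

lemma kappa_clock: "kappa alpha Tc (clock \<tau> - t0) * clock_rate \<tau> = 1"
  using Tc alpha by (simp add: kappa_def clock_def clock_rate_def algebra_simps)

lemma time_map_clock: "time_map alpha Tc t0 (clock \<tau>) = \<tau>"
  using Tc alpha by (simp add: time_map_def clock_def)

lemma clock_deriv: "(clock has_vector_derivative clock_rate \<tau>) (at \<tau> within S)"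
  unfolding has_real_derivative_iff_has_vector_derivative[symmetric] clock_def clock_rate_def
  by (auto intro!: derivative_eq_intros)

lemma clock_rate_deriv: "(clock_rate has_vector_derivative - (alpha * clock_rate \<tau>)) (at \<tau> within S)"
  unfolding has_real_derivative_iff_has_vector_derivative[symmetric] clock_rate_def
  by (auto intro!: derivative_eq_intros)

lemma clock_strict_mono: "strict_mono_on S clock"
  using Tc alpha by (intro strict_mono_onI) (simp add: clock_def)

lemma clock_lipschitz: "(alpha * Tc)-lipschitz_on {0..} clock"
  using Tc alpha clock_rate_le clock_rate_pos
  by (intro lipschitz_on_has_real_derivative[OF _ _ clock_deriv]) (auto simp: less_imp_le)

lemma clock_rate_lipschitz: "(alpha * (alpha * Tc))-lipschitz_on {0..} clock_rate"
  using Tc alpha clock_rate_le clock_rate_pos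
  by (intro lipschitz_on_has_real_derivative[OF _ _ clock_rate_deriv]) (auto simp: less_imp_le abs_mult)

lemma chain_clock:
  assumes "(f has_vector_derivative v) (at (clock \<tau>) within {t0..})" "0 \<le> \<tau>"
  shows "((\<lambda>\<tau>. f (clock \<tau>)) has_vector_derivative clock_rate \<tau> *\<^sub>R v) (at \<tau> within {0..})"
proof -
  have "clock ` {0..} \<subseteq> {t0..}" using clock_bounds by force
  from vector_diff_chain_within[OF clock_deriv has_vector_derivative_within_subset[OF assms(1) this]]
  show ?thesis by (simp add: o_def)
qed

text \<open>The exceptional set in the new time is contained in the image of the old one under
  \<open>time_map\<close>, and differentiable maps send null sets to null sets.\<close>

lemma AE_clock:
  assumes "AE t in lebesgue. t0 \<le> t \<longrightarrow> P t"
  shows "AE \<tau> in lebesgue. 0 \<le> \<tau> \<longrightarrow> P (clock \<tau>)"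
proof -
  \<comment> \<open>Cutting at \<open>t0 + Tc\<close> keeps the argument of the logarithm
    positive.\<close>
  define N where "N = {t. \<not> (t0 \<le> t \<longrightarrow> P t)} \<inter> {t0..<t0 + Tc}"
  have "negligible N"
    using assms unfolding AE_lebesgue_iff_negligible N_def by (intro negligible_Int disjI1)
  moreover have "time_map alpha Tc t0 differentiable_on N"
    unfolding differentiable_on_def
  proof
    fix t assume "t \<in> N"
    then have "1 - (t - t0) / Tc > 0" using Tc by (auto simp: N_def field_simps)
    then have "(time_map alpha Tc t0 has_real_derivative - (1 / alpha) * (- (1 / Tc) / (1 - (t - t0) / Tc))) (at t within N)"
      unfolding time_map_def by (auto intro!: derivative_eq_intros simp: divide_inverse)
    then show "time_map alpha Tc t0 differentiable at t within N"
      by (meson differentiableI has_field_derivative_def)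
  qed
  ultimately have "negligible (time_map alpha Tc t0 ` N)"
    by (intro negligible_differentiable_image_negligible) auto
  moreover have "{\<tau>. \<not> (0 \<le> \<tau> \<longrightarrow> P (clock \<tau>))} \<subseteq> time_map alpha Tc t0 ` N"
  proof
    fix \<tau> assume \<tau>: "\<tau> \<in> {\<tau>. \<not> (0 \<le> \<tau> \<longrightarrow> P (clock \<tau>))}"
    then have "clock \<tau> \<in> N" using clock_bounds[of \<tau>] by (auto simp: N_def)
    then show "\<tau> \<in> time_map alpha Tc t0 ` N" using time_map_clock[of \<tau>] by (metis image_eqI)
  qed
  ultimately show ?thesis
    unfolding AE_lebesgue_iff_negligible by (rule negligible_subset)
qed

lemma clock_tendsto: "(clock \<longlongrightarrow> t0 + Tc) at_top"
proof -
  have "((\<lambda>\<tau>. t0 + Tc * (1 - exp (- alpha * \<tau>))) \<longlongrightarrow> t0 + Tc * (1 - 0)) at_top"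
    by (intro tendsto_intros filterlim_compose[OF exp_at_bot]
        filterlim_tendsto_neg_mult_at_bot[OF tendsto_const] filterlim_ident) (use alpha in auto)
  then show ?thesis by (simp add: clock_def[abs_def])
qed

section \<open>The time-changed signal\<close>

text \<open>The formula makes the damping terms cancel: the derivative of \<open>scaled_deriv y\<close> is
  \<open>y'' (clock \<tau>) * (clock_rate \<tau>)\<^sup>2\<close>, the second derivative required of the time-changed signal.\<close>

definition scaled_deriv :: "(real \<Rightarrow> real) \<Rightarrow> real \<Rightarrow> real" where
  "scaled_deriv y \<tau> = time_deriv t0 y (clock \<tau>) * clock_rate \<tau> + alpha * y (clock \<tau>)"

text \<open>The error system sees a signal only through its second derivative, so any primitive of
  \<open>scaled_deriv\<close> would do; this one vanishes at \<open>0\<close>.\<close>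

definition scaled_signal :: "(real \<Rightarrow> real) \<Rightarrow> real \<Rightarrow> real" where
  "scaled_signal y \<tau> = integral {0..\<tau>} (scaled_deriv y)"

text \<open>A single constant works on the whole half-line because \<open>clock\<close> stays in the
  compact interval \<open>[t0, t0 + Tc]\<close>, where the signal and its derivative are bounded and
  Lipschitz, and \<open>clock_rate\<close> is bounded and Lipschitz too.\<close>

lemma scaled_deriv_lipschitz:
  assumes y: "y \<in> admissible_signals L t0"
  shows "\<exists>C. C-lipschitz_on {0..} (scaled_deriv y)"
proof -
  obtain C where C: "C-lipschitz_on {t0..t0 + Tc} y"
    "\<And>t. t \<in> {t0..t0 + Tc} \<Longrightarrow> \<bar>time_deriv t0 y t\<bar> \<le> C" "C-lipschitz_on {t0..} (time_deriv t0 y)"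
    using admissible_signals_lipschitz_on[OF y] by metis
  have sub: "clock ` {0..} \<subseteq> {t0..t0 + Tc}" "clock ` {0..} \<subseteq> {t0..}" using clock_bounds by force+
  have y': "(C * (alpha * Tc))-lipschitz_on {0..} (\<lambda>\<tau>. y (clock \<tau>))"
    by (rule lipschitz_on_compose2[OF clock_lipschitz lipschitz_on_subset[OF C(1) sub(1)]])
  have dy': "(C * (alpha * Tc))-lipschitz_on {0..} (\<lambda>\<tau>. time_deriv t0 y (clock \<tau>))"
    by (rule lipschitz_on_compose2[OF clock_lipschitz lipschitz_on_subset[OF C(3) sub(2)]])
  have "\<bar>time_deriv t0 y (clock \<tau>)\<bar> \<le> C" "\<bar>clock_rate \<tau>\<bar> \<le> alpha * Tc" if "\<tau> \<in> {0..}" for \<tau>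
    using that clock_bounds[of \<tau>] C(2)[of "clock \<tau>"] clock_rate_pos[of \<tau>] clock_rate_le[of \<tau>] by auto
  from lipschitz_on_mult_bounded[OF dy' this(1) clock_rate_lipschitz this(2)] lipschitz_on_nonneg[OF C(1)]
  have "(C * (alpha * Tc) * (alpha * Tc) + C * (alpha * (alpha * Tc)))-lipschitz_on {0..}
      (\<lambda>\<tau>. time_deriv t0 y (clock \<tau>) * clock_rate \<tau>)"
    using Tc alpha by simp
  from lipschitz_on_add[OF this lipschitz_on_cmult_real[OF y', of alpha]]
  show ?thesis unfolding scaled_deriv_def[abs_def] by blast
qed

lemma scaled_signal_deriv:
  assumes y: "y \<in> admissible_signals L t0" and \<tau>: "0 \<le> \<tau>"
  shows "(scaled_signal y has_vector_derivative scaled_deriv y \<tau>) (at \<tau> within {0..})"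
proof -
  \<comment> \<open>One unit beyond \<open>\<tau>\<close>, so that \<open>\<tau>\<close> is not the
    right endpoint and the interval agrees with \<open>{0..}\<close> near it.\<close>
  have "continuous_on {0..\<tau> + 1} (scaled_deriv y)"
    using scaled_deriv_lipschitz[OF y] by (meson lipschitz_on_continuous_on continuous_on_subset atLeastatMost_subset_iff
        Icc_subset_Ici_iff order_refl)
  from integral_has_vector_derivative[OF this, of \<tau>]
  have "(scaled_signal y has_vector_derivative scaled_deriv y \<tau>) (at \<tau> within {0..\<tau> + 1})"
    using \<tau> by (simp add: scaled_signal_def[abs_def])
  then show ?thesis by (simp add: at_within_Icc_eq_Ici)
qed

lemma time_deriv_scaled_signal:
  assumes y: "y \<in> admissible_signals L t0" and \<tau>: "0 \<le> \<tau>"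
  shows "time_deriv 0 (scaled_signal y) \<tau> = scaled_deriv y \<tau>"
  using scaled_signal_deriv[OF y \<tau>] \<tau> by (rule time_deriv_eqI)

lemma time_deriv2_scaled_signal:
  assumes y: "y \<in> admissible_signals L t0"
  shows "AE \<tau> in lebesgue. 0 \<le> \<tau> \<longrightarrow>
    (time_deriv 0 (scaled_signal y) has_vector_derivative time_deriv t0 (time_deriv t0 y) (clock \<tau>) * (clock_rate \<tau>)\<^sup>2) (at \<tau> within {0..}) \<and>
    \<bar>time_deriv t0 (time_deriv t0 y) (clock \<tau>)\<bar> \<le> L (clock \<tau> - t0)"
  using AE_clock[OF admissible_signalsD(3)[OF y]]
proof eventually_elim
  case (elim \<tau>)
  show ?case
  proof
    assume \<tau>: "0 \<le> \<tau>"
    then have t: "t0 \<le> clock \<tau>" using clock_bounds[of \<tau>] by simp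
    have 1: "((\<lambda>\<tau>. time_deriv t0 y (clock \<tau>)) has_real_derivative clock_rate \<tau> * time_deriv t0 (time_deriv t0 y) (clock \<tau>)) (at \<tau> within {0..})"
      using chain_clock[of "time_deriv t0 y"] elim \<tau>
      by (auto simp: has_real_derivative_iff_has_vector_derivative)
    have 2: "((\<lambda>\<tau>. y (clock \<tau>)) has_real_derivative clock_rate \<tau> * time_deriv t0 y (clock \<tau>)) (at \<tau> within {0..})"
      using chain_clock[OF admissible_signalsD(1)[OF y t] \<tau>]
      by (auto simp: has_real_derivative_iff_has_vector_derivative)
    have 3: "(clock_rate has_real_derivative - (alpha * clock_rate \<tau>)) (at \<tau> within {0..})"
      using clock_rate_deriv by (simp add: has_real_derivative_iff_has_vector_derivative)
    have "(scaled_deriv y has_real_derivative time_deriv t0 (time_deriv t0 y) (clock \<tau>) * (clock_rate \<tau>)\<^sup>2) (at \<tau> within {0..})"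
      unfolding scaled_deriv_def[abs_def]
      by (rule derivative_eq_intros 1 2 3 refl)+ (simp add: power2_eq_square algebra_simps)
    then have "(scaled_deriv y has_vector_derivative time_deriv t0 (time_deriv t0 y) (clock \<tau>) * (clock_rate \<tau>)\<^sup>2) (at \<tau> within {0..})"
      by (simp add: has_real_derivative_iff_has_vector_derivative)
    then have "(time_deriv 0 (scaled_signal y) has_vector_derivative time_deriv t0 (time_deriv t0 y) (clock \<tau>) * (clock_rate \<tau>)\<^sup>2) (at \<tau> within {0..})"
      by (rule has_vector_derivative_transform[rotated 2]) (use \<tau> time_deriv_scaled_signal[OF y] in auto)
    with elim t show "(time_deriv 0 (scaled_signal y) has_vector_derivative time_deriv t0 (time_deriv t0 y) (clock \<tau>) * (clock_rate \<tau>)\<^sup>2) (at \<tau> within {0..}) \<and>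
      \<bar>time_deriv t0 (time_deriv t0 y) (clock \<tau>)\<bar> \<le> L (clock \<tau> - t0)" using \<tau> by blast
  qed
qed

text \<open>The origin of the scaling of \<open>LL\<close>: the second derivative picks up the
  factor \<open>(clock_rate \<tau>)\<^sup>2\<close>, that is \<open>1 / kappa\<^sup>2\<close>, and
  so must its bound.\<close>

lemma scaled_signal_admissible:
  assumes y: "y \<in> admissible_signals L t0"
    and LL: "\<And>\<tau>. 0 \<le> \<tau> \<Longrightarrow> LL \<tau> = L (clock \<tau> - t0) * (clock_rate \<tau>)\<^sup>2"
  shows "scaled_signal y \<in> admissible_signals LL 0"
proof -
  obtain C where "C-lipschitz_on {0..} (scaled_deriv y)" using scaled_deriv_lipschitz[OF y] by blast
  then have "C-lipschitz_on {0..} (time_deriv 0 (scaled_signal y))"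
    by (rule lipschitz_on_transform) (use time_deriv_scaled_signal[OF y] in auto)
  moreover have "AE \<tau> in lebesgue. 0 \<le> \<tau> \<longrightarrow> time_deriv 0 (scaled_signal y) differentiable (at \<tau> within {0..}) \<and>
      \<bar>time_deriv 0 (time_deriv 0 (scaled_signal y)) \<tau>\<bar> \<le> LL (\<tau> - 0)"
    using time_deriv2_scaled_signal[OF y]
  proof eventually_elim
    case (elim \<tau>)
    show ?case
    proof
      assume \<tau>: "0 \<le> \<tau>"
      with elim have d: "(time_deriv 0 (scaled_signal y) has_vector_derivative
          time_deriv t0 (time_deriv t0 y) (clock \<tau>) * (clock_rate \<tau>)\<^sup>2) (at \<tau> within {0..})"
        and b: "\<bar>time_deriv t0 (time_deriv t0 y) (clock \<tau>)\<bar> \<le> L (clock \<tau> - t0)" by auto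
      have "\<bar>time_deriv 0 (time_deriv 0 (scaled_signal y)) \<tau>\<bar> \<le> LL \<tau>"
        unfolding time_deriv_eqI[OF d \<tau>] LL[OF \<tau>] abs_mult by (auto intro: mult_right_mono[OF b])
      with d show "time_deriv 0 (scaled_signal y) differentiable (at \<tau> within {0..}) \<and>
          \<bar>time_deriv 0 (time_deriv 0 (scaled_signal y)) \<tau>\<bar> \<le> LL (\<tau> - 0)"
        by (auto intro: differentiableI_vector)
    qed
  qed
  ultimately show ?thesis
    unfolding admissible_signals_def using scaled_signal_deriv[OF y] by (blast intro: differentiableI_vector)
qed

section \<open>Transport of solutions to the new time scale\<close>

text \<open>At almost every \<open>\<tau>\<close> the velocity at \<open>clock \<tau>\<close> has
  the explicit form given by some \<open>s\<close>, and the algebra of the substitution applies to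
  it. The first component is only re-timed, so \<open>s\<close> remains a legitimate selection for
  the Levant--Livne system.\<close>

lemma time_changed_solution:
  assumes y: "y \<in> admissible_signals L t0"
    and sol: "filippov_solution (pt_error_system g alpha Tc L M LL MM t0 y) t0 e"
  shows "filippov_solution (phi_error_system g LL MM 0 (scaled_signal y)) 0
    (\<lambda>\<tau>. (fst (e (clock \<tau>)), clock_rate \<tau> * snd (e (clock \<tau>)) + alpha * fst (e (clock \<tau>))))"
    (is "filippov_solution _ _ ?x")
  unfolding filippov_solution_def
proof (intro conjI allI impI)
  fix b :: real assume "0 \<le> b"
  \<comment> \<open>Absolute continuity on this one compact interval serves every
    \<open>b\<close>.\<close>
  have sub: "clock ` {0..b} \<subseteq> {t0..t0 + Tc}" using clock_bounds by force
  have "abs_continuous_on {t0..t0 + Tc} e" using filippov_solutionD(1)[OF sol] Tc by simp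
  then have e: "abs_continuous_on {0..b} (\<lambda>\<tau>. e (clock \<tau>))"
    by (rule abs_continuous_on_compose_strict_mono[OF _ lipschitz_on_subset[OF clock_lipschitz] clock_strict_mono sub]) auto
  have "abs_continuous_on {0..b} clock_rate"
    by (rule lipschitz_imp_abs_continuous_on[OF lipschitz_on_subset[OF clock_rate_lipschitz]]) auto
  with e show "abs_continuous_on {0..b} ?x"
    by (intro abs_continuous_on_Pair abs_continuous_on_add abs_continuous_on_mult
        abs_continuous_on_bounded_linear[OF e] abs_continuous_on_bounded_linear[OF e, of "\<lambda>x. alpha * fst x"]
        bounded_linear_fst bounded_linear_snd bounded_linear_const_mult)
next
  show "AE \<tau> in lebesgue. 0 \<le> \<tau> \<longrightarrow>
      (\<exists>v\<in>filippov_set (phi_error_system g LL MM 0 (scaled_signal y) \<tau>) (?x \<tau>). (?x has_vector_derivative v) (at \<tau> within {0..}))"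
    using AE_clock[OF filippov_solutionD(2)[OF sol]] time_deriv2_scaled_signal[OF y]
  proof eventually_elim
    case (elim \<tau>)
    show ?case
    proof
      assume \<tau>: "0 \<le> \<tau>"
      let ?d = "time_deriv t0 (time_deriv t0 y) (clock \<tau>)" and ?e = "e (clock \<tau>)"
      from elim \<tau> obtain v s where s: "s \<in> sign_set (fst ?e)"
        and v: "v = (- pt_h1 g alpha Tc L M LL MM t0 (fst ?e) (clock \<tau>) + snd ?e,
          - pt_h2_sel g alpha Tc L M LL MM t0 s (fst ?e) (clock \<tau>) - ?d)"
        and d: "(e has_vector_derivative v) (at (clock \<tau>) within {t0..})"
        unfolding filippov_set_pt_error_system by auto
      \<comment> \<open>Along \<open>clock\<close> the first branch of the definitions is active,
        and \<open>LL\<close> is evaluated at \<open>\<tau>\<close> itself.\<close>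
      note v' = v[unfolded pt_h1_def pt_h2_sel_def time_map_clock if_P[OF clock_bounds[OF \<tau>]]]
      note alg = time_change_algebra[OF kappa_clock v']
      have e: "((\<lambda>\<tau>. e (clock \<tau>)) has_vector_derivative clock_rate \<tau> *\<^sub>R v) (at \<tau> within {0..})"
        by (rule chain_clock[OF d \<tau>])
      have e1: "((\<lambda>\<tau>. fst (e (clock \<tau>))) has_real_derivative clock_rate \<tau> * fst v) (at \<tau> within {0..})"
        using bounded_linear.has_vector_derivative[OF bounded_linear_fst e]
        by (simp add: has_real_derivative_iff_has_vector_derivative)
      have e2: "((\<lambda>\<tau>. snd (e (clock \<tau>))) has_real_derivative clock_rate \<tau> * snd v) (at \<tau> within {0..})"
        using bounded_linear.has_vector_derivative[OF bounded_linear_snd e]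
        by (simp add: has_real_derivative_iff_has_vector_derivative)
      have clock_rate: "(clock_rate has_real_derivative - (alpha * clock_rate \<tau>)) (at \<tau> within {0..})"
        using clock_rate_deriv by (simp add: has_real_derivative_iff_has_vector_derivative)
      have "((\<lambda>\<tau>. clock_rate \<tau> * snd (e (clock \<tau>)) + alpha * fst (e (clock \<tau>))) has_real_derivative
          - (alpha * clock_rate \<tau>) * snd ?e + clock_rate \<tau> * (clock_rate \<tau> * snd v) + alpha * (clock_rate \<tau> * fst v)) (at \<tau> within {0..})"
        by (rule derivative_eq_intros e1 e2 clock_rate refl)+ simp
      note e2' = this[unfolded alg(2)]
      have "(?x has_vector_derivative (- phi1 g MM (LL \<tau>) (fst ?e) + (clock_rate \<tau> * snd ?e + alpha * fst ?e),
          - phi2_sel g MM (LL \<tau>) s (fst ?e) - ?d * (clock_rate \<tau>)\<^sup>2)) (at \<tau> within {0..})"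
        using e1[unfolded alg(1)] e2' unfolding has_real_derivative_iff_has_vector_derivative
        by (rule has_vector_derivative_Pair)
      moreover have "time_deriv 0 (time_deriv 0 (scaled_signal y)) \<tau> = ?d * (clock_rate \<tau>)\<^sup>2"
        using elim \<tau> by (intro time_deriv_eqI) auto
      ultimately show "\<exists>v\<in>filippov_set (phi_error_system g LL MM 0 (scaled_signal y) \<tau>) (?x \<tau>).
          (?x has_vector_derivative v) (at \<tau> within {0..})"
        unfolding filippov_set_phi_error_system using s by (intro bexI) (auto intro!: image_eqI[of _ _ s])
    qed
  qed
qed

lemma pt_error_system_zero:
  assumes g: "suitable_gains g" and t0: "0 \<le> t0"
    and L: "positive_log_rate_le L M" and LL: "positive_log_rate_le LL MM"
    and scale: "\<And>\<tau>. 0 \<le> \<tau> \<Longrightarrow> LL \<tau> = L (clock \<tau> - t0) * (clock_rate \<tau>)\<^sup>2"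
    and y: "y \<in> admissible_signals L t0"
    and sol: "filippov_solution (pt_error_system g alpha Tc L M LL MM t0 y) t0 e"
    and t: "t0 + Tc \<le> t"
  shows "e t = 0"
proof -
  obtain \<xi> where \<xi>: "0 \<le> \<xi>"
    "\<And>\<tau>. \<xi> \<le> \<tau> \<Longrightarrow> (fst (e (clock \<tau>)), clock_rate \<tau> * snd (e (clock \<tau>)) + alpha * fst (e (clock \<tau>))) = 0"
    using phi_error_system_settles[OF g LL order_refl scaled_signal_admissible[OF y scale] time_changed_solution[OF y sol]] by blast
  \<comment> \<open>The change of state is invertible because \<open>clock_rate\<close> is
    positive.\<close>
  have zero: "e (clock \<tau>) = 0" if "\<xi> \<le> \<tau>" for \<tau>
    using \<xi>(2)[OF that] clock_rate_pos[of \<tau>] by (auto simp: prod_eq_iff zero_prod_def)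
  \<comment> \<open>\<open>t0 + Tc\<close> corresponds to infinite \<open>\<tau>\<close>, so the
    value there is reached only as a limit along \<open>clock\<close>.\<close>
  have "filterlim clock (at (t0 + Tc) within {t0..}) at_top"
    unfolding filterlim_at
  proof
    show "\<forall>\<^sub>F \<tau> in at_top. clock \<tau> \<in> {t0..} \<and> clock \<tau> \<noteq> t0 + Tc"
      using eventually_ge_at_top[of 0] by eventually_elim (use clock_bounds in force)
  qed (rule clock_tendsto)
  then have "((\<lambda>\<tau>. e (clock \<tau>)) \<longlongrightarrow> e (t0 + Tc)) at_top"
    using Tc by (intro filterlim_compose[OF filippov_solution_tendsto[OF sol]]) auto
  moreover have "((\<lambda>\<tau>. e (clock \<tau>)) \<longlongrightarrow> 0) at_top"
    by (rule tendsto_eventually) (rule eventually_mono[OF eventually_ge_at_top[of \<xi>] zero])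
  ultimately have "e (t0 + Tc) = 0"
    using tendsto_unique by (metis trivial_limit_at_top_linorder)
  moreover have "filippov_solution (phi_error_system g L M t0 y) (t0 + Tc) e"
  proof (rule filippov_solution_restrict[OF sol])
    \<comment> \<open>From \<open>t0 + Tc\<close> on, both correction terms are given by their
      second branch.\<close>
    show "AE t in lebesgue. t0 + Tc \<le> t \<longrightarrow>
        phi_error_system g L M t0 y t = pt_error_system g alpha Tc L M LL MM t0 y t"
      by (rule AE_I2) (simp add: phi_error_system_def pt_error_system_def error_system_def pt_h1_def pt_h2_def)
  qed (use Tc in simp)
  ultimately show ?thesis
    using phi_error_system_stays_zero[OF g L t0 _ t y] Tc by simp
qed

end

section \<open>Linear growth and the least settling bound\<close>

lemma abs_sqrt_le: "\<bar>sqrt w\<bar> \<le> 1 + \<bar>w\<bar>"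
proof -
  have "\<bar>w\<bar> \<le> (1 + \<bar>w\<bar>)\<^sup>2" by (simp add: power2_eq_square algebra_simps)
  then have "sqrt \<bar>w\<bar> \<le> 1 + \<bar>w\<bar>" by (intro real_le_lsqrt) auto
  moreover have "\<bar>sqrt w\<bar> = sqrt \<bar>w\<bar>"
    by (cases "0 \<le> w") (simp_all add: real_sqrt_minus)
  ultimately show ?thesis by simp
qed

text \<open>The constant involves \<open>l\<close> only through an upper bound, which makes the
  growth estimate uniform over a time interval.\<close>

lemma abs_phi1_le:
  assumes "0 \<le> l" "l \<le> l'"
  shows "\<bar>phi1 g M l w\<bar> \<le> (\<bar>lambda1 g\<bar> * sqrt l' + \<bar>mu1 g * M\<bar>) * (1 + \<bar>w\<bar>)"
proof -
  have "\<bar>phi1 g M l w\<bar> \<le> \<bar>lambda1 g * sqrt l * sqrt w\<bar> + \<bar>mu1 g * M * w\<bar>"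
    unfolding phi1_def signed_power_half by (rule abs_triangle_ineq)
  also have "\<dots> = \<bar>lambda1 g\<bar> * sqrt l * \<bar>sqrt w\<bar> + \<bar>mu1 g * M\<bar> * \<bar>w\<bar>"
    using assms by (simp add: abs_mult)
  also have "\<dots> \<le> \<bar>lambda1 g\<bar> * sqrt l' * (1 + \<bar>w\<bar>) + \<bar>mu1 g * M\<bar> * (1 + \<bar>w\<bar>)"
    using assms abs_sqrt_le by (intro add_mono mult_mono) auto
  finally show ?thesis by (simp add: algebra_simps)
qed

lemma abs_phi2_sel_le:
  assumes "0 \<le> l" "l \<le> l'" "\<bar>s\<bar> \<le> 1"
  shows "\<bar>phi2_sel g M l s w\<bar>
    \<le> (\<bar>lambda0 g\<bar> * l' + \<bar>lambda1 g * mu0 g\<bar> * sqrt l' * \<bar>M\<bar> + \<bar>mu0 g * mu1 g * M\<^sup>2\<bar>) * (1 + \<bar>w\<bar>)"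
proof -
  have "\<bar>phi2_sel g M l s w\<bar> \<le> \<bar>lambda0 g * l * s\<bar> + \<bar>lambda1 g * mu0 g * sqrt l * M * sqrt w\<bar>
      + \<bar>mu0 g * mu1 g * M\<^sup>2 * w\<bar>"
    unfolding phi2_sel_def by linarith
  also have "\<dots> = \<bar>lambda0 g\<bar> * l * \<bar>s\<bar> + \<bar>lambda1 g * mu0 g\<bar> * sqrt l * \<bar>M\<bar> * \<bar>sqrt w\<bar>
      + \<bar>mu0 g * mu1 g * M\<^sup>2\<bar> * \<bar>w\<bar>"
    using assms by (simp add: abs_mult)
  also have "\<dots> \<le> \<bar>lambda0 g\<bar> * l' * (1 + \<bar>w\<bar>) + \<bar>lambda1 g * mu0 g\<bar> * sqrt l' * \<bar>M\<bar> * (1 + \<bar>w\<bar>)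
      + \<bar>mu0 g * mu1 g * M\<^sup>2\<bar> * (1 + \<bar>w\<bar>)"
    using assms abs_sqrt_le by (intro add_mono mult_mono) (auto intro: order_trans)
  finally show ?thesis by (simp add: algebra_simps)
qed

section \<open>A Gronwall estimate from below\<close>

text \<open>The quantity \<open>1 + (norm (e t))\<^sup>2\<close>, weighted by
  \<open>exp (3 * C * (t - t0))\<close>, is nondecreasing: its derivative is nonnegative almost
  everywhere and it is absolutely continuous. The summand \<open>1\<close> absorbs the part of the
  growth bound that persists at the origin.\<close>

lemma filippov_solution_lower_bound:
  fixes e :: "real \<Rightarrow> real \<times> real"
  assumes sol: "filippov_solution F t0 e" and C: "0 \<le> C"
    and growth: "\<And>t x v. t \<in> {t0..b} \<Longrightarrow> v \<in> filippov_set (F t) x \<Longrightarrow> norm v \<le> C * (1 + norm x)"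
    and b: "t0 \<le> b"
  shows "1 + (norm (e t0))\<^sup>2 \<le> (1 + (norm (e b))\<^sup>2) * exp (3 * C * (b - t0))"
proof -
  \<comment> \<open>The squared norm is written out in coordinates so that the rules for products
    apply.\<close>
  define f where "f t = (1 + (fst (e t) * fst (e t) + snd (e t) * snd (e t))) * exp (3 * C * (t - t0))" for t
  have norm2: "fst x * fst x + snd x * snd x = (norm x)\<^sup>2" for x :: "real \<times> real"
    by (simp add: norm_prod_def power2_eq_square)
  have "f t0 \<le> f b"
  proof (rule abs_continuous_on_AE_deriv_nonneg[OF _ b])
    have ac: "abs_continuous_on {t0..b} e" by (rule filippov_solutionD(1)[OF sol b])
    have "(3 * C * exp (3 * C * (b - t0)))-lipschitz_on {t0..b} (\<lambda>t. exp (3 * C * (t - t0)))"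
    proof (rule lipschitz_on_has_real_derivative)
      show "((\<lambda>t. exp (3 * C * (t - t0))) has_vector_derivative 3 * C * exp (3 * C * (t - t0)))
          (at t within {t0..b})" for t
        unfolding has_real_derivative_iff_has_vector_derivative[symmetric]
        by (auto intro!: derivative_eq_intros)
      show "\<bar>3 * C * exp (3 * C * (t - t0))\<bar> \<le> 3 * C * exp (3 * C * (b - t0))" if "t \<in> {t0..b}" for t
        using that C by (auto simp: abs_mult intro!: mult_left_mono)
    qed (use C in auto)
    from lipschitz_imp_abs_continuous_on[OF this]
    show "abs_continuous_on {t0..b} f"
      unfolding f_def
      by (intro abs_continuous_on_mult abs_continuous_on_add abs_continuous_on_bounded_linear[OF ac]
          bounded_linear_fst bounded_linear_snd lipschitz_imp_abs_continuous_on[OF lipschitz_on_constant])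
    show "negligible {t. \<not> (t0 \<le> t \<longrightarrow>
        (\<exists>v\<in>filippov_set (F t) (e t). (e has_vector_derivative v) (at t within {t0..})))}"
      using filippov_solutionD(2)[OF sol] unfolding AE_lebesgue_iff_negligible .
    fix t
    assume "t \<in> {t0..b} - {t. \<not> (t0 \<le> t \<longrightarrow>
        (\<exists>v\<in>filippov_set (F t) (e t). (e has_vector_derivative v) (at t within {t0..})))}"
    then obtain v where t: "t \<in> {t0..b}" and v: "v \<in> filippov_set (F t) (e t)"
      and "(e has_vector_derivative v) (at t within {t0..})" by auto
    then have d: "(e has_vector_derivative v) (at t within {t0..b})"
      by (auto intro: has_vector_derivative_within_subset)
    define x where "x = e t"
    have e1: "((\<lambda>t. fst (e t)) has_real_derivative fst v) (at t within {t0..b})"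
      using bounded_linear.has_vector_derivative[OF bounded_linear_fst d]
      by (simp add: has_real_derivative_iff_has_vector_derivative)
    have e2: "((\<lambda>t. snd (e t)) has_real_derivative snd v) (at t within {t0..b})"
      using bounded_linear.has_vector_derivative[OF bounded_linear_snd d]
      by (simp add: has_real_derivative_iff_has_vector_derivative)
    have "(f has_real_derivative (2 * (x \<bullet> v) + 3 * C * (1 + (norm x)\<^sup>2)) * exp (3 * C * (t - t0)))
        (at t within {t0..b})"
      unfolding f_def
      by (rule derivative_eq_intros e1 e2 refl)+
        (simp add: x_def norm2[symmetric] inner_prod_def algebra_simps)
    moreover have "2 * (x \<bullet> v) + 3 * C * (1 + (norm x)\<^sup>2) \<ge> 0"
    proof -
      have "\<bar>x \<bullet> v\<bar> \<le> norm x * norm v" by (rule Cauchy_Schwarz_ineq2)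
      also have "\<dots> \<le> norm x * (C * (1 + norm x))"
        using growth[OF t v] by (intro mult_left_mono) (auto simp: x_def)
      finally have "2 * (x \<bullet> v) \<ge> - (C * (2 * (norm x + (norm x)\<^sup>2)))"
        by (simp add: algebra_simps power2_eq_square abs_le_iff)
      \<comment> \<open>This fixes the factor \<open>3\<close> in the exponent: with
        \<open>n = norm x\<close> the difference of the two sides is
        \<open>(n - 1)\<^sup>2 + 2\<close>.\<close>
      moreover have "2 * (norm x + (norm x)\<^sup>2) \<le> 3 * (1 + (norm x)\<^sup>2)"
        using zero_le_power2[of "norm x - 1"] by (simp add: power2_eq_square algebra_simps)
      then have "C * (2 * (norm x + (norm x)\<^sup>2)) \<le> C * (3 * (1 + (norm x)\<^sup>2))"
        using C by (rule mult_left_mono)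
      ultimately show ?thesis by (simp add: algebra_simps)
    qed
    ultimately show "\<exists>d\<ge>0. (f has_real_derivative d) (at t within {t0..b})"
      by (metis exp_ge_zero mult_nonneg_nonneg)
  qed
  then show ?thesis by (simp add: f_def norm2)
qed

text \<open>The test signal for the lower bound: its second derivative vanishes at every time from
  \<open>t0\<close> on, not merely almost everywhere, as a growth bound at every instant
  requires.\<close>

lemma zero_signal_admissible:
  assumes "\<And>s. 0 \<le> s \<Longrightarrow> 0 \<le> L s"
  shows "(\<lambda>_. 0) \<in> admissible_signals L t0"
    and "t0 \<le> t \<Longrightarrow> time_deriv t0 (time_deriv t0 (\<lambda>_. 0)) t = 0"
proof -
  have d1: "time_deriv t0 (\<lambda>_. 0) t = 0" if "t0 \<le> t" for t
    using that by (intro time_deriv_eqI) auto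
  have d2: "(time_deriv t0 (\<lambda>_. 0) has_vector_derivative 0) (at t within {t0..})" if "t0 \<le> t" for t
    by (rule has_vector_derivative_transform[of _ _ _ "\<lambda>_. 0"]) (use that d1 in auto)
  then show e2: "t0 \<le> t \<Longrightarrow> time_deriv t0 (time_deriv t0 (\<lambda>_. 0)) t = 0" for t
    by (intro time_deriv_eqI)
  have "0-lipschitz_on {t0..} (time_deriv t0 (\<lambda>_. 0))"
    by (rule lipschitz_on_transform[OF lipschitz_on_constant[of _ 0]]) (use d1 in auto)
  moreover have "AE t in lebesgue. t0 \<le> t \<longrightarrow>
      time_deriv t0 (\<lambda>_. 0) differentiable (at t within {t0..}) \<and>
      \<bar>time_deriv t0 (time_deriv t0 (\<lambda>_. 0)) t\<bar> \<le> L (t - t0)"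
    using d2 e2 assms by (intro AE_I2) (auto intro: differentiableI_vector)
  ultimately show "(\<lambda>_. 0) \<in> admissible_signals L t0"
    unfolding admissible_signals_def by auto
qed

text \<open>On \<open>[t0, t0 + b]\<close> the distance to the singularity of \<open>kappa\<close>
  is at least \<open>Tc - b\<close>, so \<open>kappa\<close> stays bounded, and so does
  \<open>LL\<close> along the time map. All coefficients of the linearly growing terms are then
  uniformly bounded.\<close>

lemma pt_error_system_linear_growth:
  assumes Tc: "0 < Tc" and alpha: "0 < alpha" and b: "0 \<le> b" "b < Tc"
    and L: "positive_log_rate_le L M"
    and scale: "\<And>t. t \<in> {t0..<t0 + Tc} \<Longrightarrow>
           LL (time_map alpha Tc t0 t) = L (t - t0) * (1 / kappa alpha Tc (t - t0))\<^sup>2"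
    and y: "\<And>t. t0 \<le> t \<Longrightarrow> time_deriv t0 (time_deriv t0 y) t = 0"
  obtains C where "0 \<le> C"
    "\<And>t x v. t \<in> {t0..t0 + b} \<Longrightarrow> v \<in> filippov_set (pt_error_system g alpha Tc L M LL MM t0 y t) x \<Longrightarrow>
       norm v \<le> C * (1 + norm x)"
proof -
  have Lpos: "0 < L s" if "0 \<le> s" for s using L that by (simp add: positive_log_rate_le_def)
  have "L differentiable_on {0..}"
    using L by (auto simp: positive_log_rate_le_def differentiable_on_def)
  then have "continuous_on {0..b} L"
    by (intro continuous_on_subset[OF differentiable_imp_continuous_on]) auto
  then have "bounded (L ` {0..b})" by (simp add: compact_imp_bounded compact_continuous_image)
  then obtain l0 where "\<forall>x\<in>L ` {0..b}. norm x \<le> l0"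
    unfolding bounded_iff by blast
  then have l0: "L s \<le> l0" if "s \<in> {0..b}" for s
    using that by (auto dest!: bspec[of _ _ s])
  \<comment> \<open>An upper bound for \<open>LL\<close>: \<open>l0\<close> bounds \<open>L\<close>
    on \<open>[0, b]\<close>, and \<open>1 / kappa\<close> is at most
    \<open>alpha * Tc\<close>.\<close>
  define l where "l = l0 * (alpha * Tc)\<^sup>2"
  define K where "K = 1 / (alpha * (Tc - b))"
  define P1 where "P1 = \<bar>lambda1 g\<bar> * sqrt l + \<bar>mu1 g * MM\<bar>"
  define P2 where "P2 = \<bar>lambda0 g\<bar> * l + \<bar>lambda1 g * mu0 g\<bar> * sqrt l * \<bar>MM\<bar> + \<bar>mu0 g * mu1 g * MM\<^sup>2\<bar>"
  \<comment> \<open>The bracket bounds the first velocity component, its \<open>1\<close> coming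
    from \<open>snd x\<close>; the other summand bounds the second component.\<close>
  define C where "C = (K * (alpha + P1) + 1) + K\<^sup>2 * (alpha\<^sup>2 + P2 + alpha * P1)"
  have "0 < l0" using l0[of 0] Lpos[of 0] b by simp
  then have pos: "0 \<le> l" "0 \<le> K" "0 \<le> P1" "0 \<le> P2"
    using Tc alpha b by (auto simp: l_def K_def P1_def P2_def)
  then have "0 \<le> C" using alpha by (simp add: C_def)
  moreover have "norm v \<le> C * (1 + norm x)"
    if t: "t \<in> {t0..t0 + b}" and v: "v \<in> filippov_set (pt_error_system g alpha Tc L M LL MM t0 y t) x"
    for t v and x :: "real \<times> real"
  proof -
    define k where "k = kappa alpha Tc (t - t0)"
    define l' where "l' = LL (time_map alpha Tc t0 t)"
    have t': "t \<in> {t0..<t0 + Tc}" using t b by auto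
    have k: "0 \<le> k" "k \<le> K"
      using t b alpha by (auto simp: k_def kappa_def K_def intro!: divide_left_mono mult_left_mono)
    have l'_eq: "l' = L (t - t0) * (alpha * (Tc - (t - t0)))\<^sup>2"
      unfolding l'_def scale[OF t'] by (simp add: kappa_def)
    have l': "0 \<le> l'" "l' \<le> l"
      unfolding l'_eq l_def using t b Tc alpha Lpos[of "t - t0"] l0[of "t - t0"] \<open>0 < l0\<close>
      by (auto intro!: mult_mono power_mono mult_left_mono)
    define w where "w = fst x"
    from v obtain s where s': "s \<in> sign_set w"
      and v': "v = (- (k * (- alpha * w + phi1 g MM l' w)) + snd x,
        - (k\<^sup>2 * (alpha\<^sup>2 * w + phi2_sel g MM l' s w - alpha * phi1 g MM l' w))
          - time_deriv t0 (time_deriv t0 y) t)"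
      unfolding filippov_set_pt_error_system pt_h1_def pt_h2_sel_def if_P[OF t'] k_def l'_def w_def
      by (rule imageE)
    have s: "\<bar>s\<bar> \<le> 1" by (rule sign_set_abs_le[OF s'])
    have v1: "fst v = - (k * (- alpha * w + phi1 g MM l' w)) + snd x"
      and v2: "snd v = - (k\<^sup>2 * (alpha\<^sup>2 * w + phi2_sel g MM l' s w - alpha * phi1 g MM l' w))"
      using v' y[of t] t by simp_all
    define n where "n = 1 + norm x"
    have x: "\<bar>w\<bar> \<le> n" "1 + \<bar>w\<bar> \<le> n" "\<bar>snd x\<bar> \<le> n"
      using norm_fst_le[of "fst x" "snd x"] norm_snd_le[of "snd x" "fst x"] by (auto simp: n_def w_def)
    have p1: "\<bar>phi1 g MM l' w\<bar> \<le> P1 * n"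
      using abs_phi1_le[OF l', of g MM w] mult_left_mono[OF x(2) pos(3)] by (simp add: P1_def)
    have p2: "\<bar>phi2_sel g MM l' s w\<bar> \<le> P2 * n"
      using abs_phi2_sel_le[OF l' s, of g MM w] mult_left_mono[OF x(2) pos(4)] by (simp add: P2_def)
    have "\<bar>- alpha * w + phi1 g MM l' w\<bar> \<le> alpha * \<bar>w\<bar> + \<bar>phi1 g MM l' w\<bar>"
      using alpha abs_triangle_ineq[of "- alpha * w" "phi1 g MM l' w"] by (simp add: abs_mult)
    also have "\<dots> \<le> alpha * n + P1 * n"
      using p1 x alpha by (intro add_mono mult_left_mono) auto
    finally have "k * \<bar>- alpha * w + phi1 g MM l' w\<bar> \<le> K * (alpha * n + P1 * n)"
      using k pos by (intro mult_mono) auto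
    then have b1: "\<bar>fst v\<bar> \<le> K * (alpha * n + P1 * n) + n"
      unfolding v1 using x(3) k(1) abs_triangle_ineq[of "- (k * (- alpha * w + phi1 g MM l' w))" "snd x"]
      by (simp add: abs_mult)
    have "\<bar>alpha\<^sup>2 * w + phi2_sel g MM l' s w - alpha * phi1 g MM l' w\<bar>
        \<le> \<bar>alpha\<^sup>2 * w\<bar> + \<bar>phi2_sel g MM l' s w\<bar> + \<bar>alpha * phi1 g MM l' w\<bar>" by linarith
    also have "\<dots> \<le> alpha\<^sup>2 * n + P2 * n + alpha * (P1 * n)"
      using p1 p2 x alpha by (auto simp: abs_mult intro!: add_mono mult_left_mono)
    finally have "k\<^sup>2 * \<bar>alpha\<^sup>2 * w + phi2_sel g MM l' s w - alpha * phi1 g MM l' w\<bar>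
        \<le> K\<^sup>2 * (alpha\<^sup>2 * n + P2 * n + alpha * (P1 * n))"
      using k pos by (intro mult_mono power_mono) auto
    then have b2: "\<bar>snd v\<bar> \<le> K\<^sup>2 * (alpha\<^sup>2 * n + P2 * n + alpha * (P1 * n))"
      unfolding v2 by (simp add: abs_mult)
    have "norm v \<le> \<bar>fst v\<bar> + \<bar>snd v\<bar>"
      using norm_Pair_le[of "fst v" "snd v"] by simp
    also have "\<dots> \<le> (K * (alpha * n + P1 * n) + n) + K\<^sup>2 * (alpha\<^sup>2 * n + P2 * n + alpha * (P1 * n))"
      by (rule add_mono[OF b1 b2])
    also have "\<dots> = C * n" by (simp add: C_def algebra_simps)
    finally show ?thesis by (simp add: n_def)
  qed
  ultimately show ?thesis using that by blast
qed

section \<open>Lower bounds for the settling time\<close>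

text \<open>A settling instant must serve all signals and all solutions from \<open>e0\<close>, so
  one solution without zeros on \<open>[t0, t0 + b]\<close> excludes every instant in that
  interval.\<close>

lemma settling_time_ge:
  assumes y: "y \<in> Y t0" and sol: "filippov_solution (F t0 y) t0 e" "e t0 = e0"
    and nz: "\<And>t. t \<in> {t0..t0 + b} \<Longrightarrow> e t \<noteq> 0"
  shows "ereal b \<le> settling_time Y F e0 t0"
proof -
  have "ereal (t0 + b) \<le> Inf {ereal \<xi> | \<xi>. t0 \<le> \<xi> \<and>
        (\<forall>y\<in>Y t0. \<forall>e. filippov_solution (F t0 y) t0 e \<and> e t0 = e0 \<longrightarrow>
           (e \<longlongrightarrow> 0) (at \<xi> within {t0..}))}"
  proof (rule Inf_greatest, safe)
    fix \<xi> assume \<xi>: "t0 \<le> \<xi>" and "\<forall>y\<in>Y t0. \<forall>e. filippov_solution (F t0 y) t0 e \<and> e t0 = e0 \<longrightarrow>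
           (e \<longlongrightarrow> 0) (at \<xi> within {t0..})"
    then have "(e \<longlongrightarrow> 0) (at \<xi> within {t0..})" using y sol by blast
    then have "e \<xi> = 0"
      using tendsto_unique[OF at_within_Ici_neq_bot[OF \<xi>] filippov_solution_tendsto[OF sol(1) \<xi>]] by blast
    with nz[of \<xi>] \<xi> show "ereal (t0 + b) \<le> ereal \<xi>" by force
  qed
  then have "ereal (t0 + b) - ereal t0 \<le> settling_time Y F e0 t0"
    unfolding settling_time_def by (intro ereal_minus_mono) auto
  then show ?thesis by simp
qed

text \<open>Solutions are known to exist for almost every initial state only. The states of norm
  above \<open>R\<close> form a nonempty open set, which is not null and thus contains a state with
  a solution.\<close>

lemma forward_complete_large_solution:
  assumes "forward_complete Y F t0" "y \<in> Y t0"
  obtains e where "filippov_solution (F t0 y) t0 e" "R < norm (e t0)"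
proof -
  have "AE e0 in lborel. \<exists>e. filippov_solution (F t0 y) t0 e \<and> e t0 = e0"
    using assms by (simp add: forward_complete_def)
  then have neg: "negligible {e0. \<not> (\<exists>e. filippov_solution (F t0 y) t0 e \<and> e t0 = e0)}"
    unfolding AE_lebesgue_iff_negligible[symmetric] by (rule AE_completion)
  have "open {e0 :: real \<times> real. R < norm e0}"
    by (intro open_Collect_less continuous_intros)
  moreover have "(\<bar>R\<bar> + 1, 0) \<in> {e0 :: real \<times> real. R < norm e0}"
    by (simp add: norm_Pair)
  ultimately have large: "\<not> negligible {e0 :: real \<times> real. R < norm e0}"
    by (intro open_not_negligible) blast+
  have "\<not> {e0. R < norm e0} \<subseteq> {e0. \<not> (\<exists>e. filippov_solution (F t0 y) t0 e \<and> e t0 = e0)}"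
    by (rule contrapos_nn[OF large negligible_subset[OF neg]])
  then obtain e0 where "\<not> (e0 \<in> {e0. R < norm e0} \<longrightarrow>
      e0 \<in> {e0. \<not> (\<exists>e. filippov_solution (F t0 y) t0 e \<and> e t0 = e0)})"
    unfolding subset_iff not_all by (rule exE)
  then obtain e where "R < norm e0" "filippov_solution (F t0 y) t0 e" "e t0 = e0" by auto
  then show ?thesis using that[of e] by simp
qed

text \<open>The relation between \<open>L\<close> and \<open>LL\<close> is assumed for
  \<open>t0\<close>, whereas a settling bound concerns every initial time \<open>t1\<close>. Both
  sides depend only on elapsed time, so the relation carries over.\<close>

lemma time_scaling_bound:
  assumes "0 < Tc" "0 < alpha" "0 \<le> \<tau>"
    and "\<forall>t\<in>{t0..<t0 + Tc}.
           LL (time_map alpha Tc t0 t) = L (t - t0) * (1 / kappa alpha Tc (t - t0))\<^sup>2"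
  shows "LL \<tau> = L (time_scaling.clock alpha Tc t1 \<tau> - t1) * (time_scaling.clock_rate alpha Tc \<tau>)\<^sup>2"
proof -
  interpret t0: time_scaling alpha Tc t0 using assms by unfold_locales
  interpret t1: time_scaling alpha Tc t1 using assms by unfold_locales
  have "1 / kappa alpha Tc (t0.clock \<tau> - t0) = t0.clock_rate \<tau>"
    using inverse_unique[OF t0.kappa_clock] by (simp add: divide_inverse)
  moreover have "t0.clock \<tau> - t0 = t1.clock \<tau> - t1" by (simp add: t0.clock_def t1.clock_def)
  ultimately show ?thesis
    using assms(4) t0.clock_bounds[OF assms(3)] t0.time_map_clock[of \<tau>] by metis
qed

theorem theorem2:
  fixes g :: gains and Tc alpha t0 M MM :: real and L LL :: "real \<Rightarrow> real"
  assumes "0 < lambda0 g" and "0 < lambda1 g"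
    and "hurwitz_polynomial [: mu0 g * mu1 g, mu1 g, 1 :]"
    and "suitable_gains g"
    and "0 < Tc" and "0 < alpha" and "0 \<le> t0"
    and "positive_log_rate_le L M"
    and "\<forall>t\<in>{t0..<t0 + Tc}.
           LL (time_map alpha Tc t0 t) = L (t - t0) * (1 / kappa alpha Tc (t - t0))\<^sup>2"
    and "positive_log_rate_le LL MM"
    and "forward_complete (admissible_signals L) (pt_error_system g alpha Tc L M LL MM) t0"
  shows "(\<forall>y\<in>admissible_signals L t0. \<forall>z.
            filippov_solution
              (differentiator (pt_h1 g alpha Tc L M LL MM t0) (pt_h2 g alpha Tc L M LL MM t0) y) t0 z
            \<longrightarrow> (\<forall>t\<ge>t0 + Tc. fst (z t) = y t \<and> snd (z t) = time_deriv t0 y t)) \<and>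
         ((\<forall>B::real. \<exists>e0.
             ereal B < settling_time (admissible_signals L) (phi_error_system g L M) e0 t0)
          \<longrightarrow> is_least_UBST
                (settling_time (admissible_signals L) (pt_error_system g alpha Tc L M LL MM)) Tc)"
proof (intro conjI ballI allI impI)
  note g = assms(4) and Tc = assms(5) and alpha = assms(6) and t0 = assms(7) and L = assms(8)
    and scale = assms(9) and LL = assms(10) and fc = assms(11)
  \<comment> \<open>Stated for every initial time \<open>t1\<close>: exactness uses it at
    \<open>t0\<close>, the settling bound at all of them.\<close>
  have zero: "e t = 0"
    if "0 \<le> t1" "y \<in> admissible_signals L t1"
      "filippov_solution (pt_error_system g alpha Tc L M LL MM t1 y) t1 e" "t1 + Tc \<le> t" for t1 y e t
  proof -
    interpret time_scaling alpha Tc t1 using Tc alpha by unfold_locales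
    show ?thesis
      using pt_error_system_zero[OF g that(1) L LL time_scaling_bound[OF Tc alpha _ scale] that(2-4)] .
  qed
  {
    fix y z t
    assume y: "y \<in> admissible_signals L t0"
      and "filippov_solution
        (differentiator (pt_h1 g alpha Tc L M LL MM t0) (pt_h2 g alpha Tc L M LL MM t0) y) t0 z"
      and "t0 + Tc \<le> t"
    then have "z t - (y t, time_deriv t0 y t) = 0"
      using zero[OF t0 y differentiator_error_solution[OF y]] by blast
    then show "fst (z t) = y t" "snd (z t) = time_deriv t0 y t" by (simp_all add: prod_eq_iff)
  }
  show "is_least_UBST (settling_time (admissible_signals L) (pt_error_system g alpha Tc L M LL MM)) Tc"
    unfolding is_least_UBST_def
  proof (intro conjI allI impI)
    show "is_UBST (settling_time (admissible_signals L) (pt_error_system g alpha Tc L M LL MM)) Tc"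
      unfolding is_UBST_def
    proof (intro allI impI)
      fix e0 :: "real \<times> real" and t1 :: real assume t1: "0 \<le> t1"
      let ?S = "{ereal \<xi> | \<xi>. t1 \<le> \<xi> \<and> (\<forall>y\<in>admissible_signals L t1. \<forall>e.
        filippov_solution (pt_error_system g alpha Tc L M LL MM t1 y) t1 e \<and> e t1 = e0 \<longrightarrow>
           (e \<longlongrightarrow> 0) (at \<xi> within {t1..}))}"
      have "(e \<longlongrightarrow> 0) (at (t1 + Tc) within {t1..})"
        if "y \<in> admissible_signals L t1"
          "filippov_solution (pt_error_system g alpha Tc L M LL MM t1 y) t1 e" for y e
        using filippov_solution_tendsto[OF that(2), of "t1 + Tc"] zero[OF t1 that, of "t1 + Tc"] Tc by simp
      \<comment> \<open>The instant \<open>t1 + Tc\<close> is itself a common settling instant, so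
        the infimum cannot exceed it.\<close>
      then have "ereal (t1 + Tc) \<in> ?S" using Tc by (intro CollectI exI[of _ "t1 + Tc"]) auto
      then have "Inf ?S - ereal t1 \<le> ereal (t1 + Tc) - ereal t1"
        by (intro ereal_minus_mono Inf_lower) auto
      then show "settling_time (admissible_signals L) (pt_error_system g alpha Tc L M LL MM) e0 t1 \<le> ereal Tc"
        unfolding settling_time_def by simp
    qed
  next
    fix B
    assume B: "is_UBST (settling_time (admissible_signals L) (pt_error_system g alpha Tc L M LL MM)) B"
    show "Tc \<le> B"
    proof (rule ccontr)
      assume "\<not> Tc \<le> B"
      \<comment> \<open>A midpoint strictly between \<open>B\<close> and \<open>Tc\<close>; the
        maximum with \<open>0\<close> keeps it nonnegative when \<open>B\<close> is
        negative.\<close>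
      define b where "b = (max 0 B + Tc) / 2"
      have b: "0 \<le> b" "b < Tc" "B < b" using Tc \<open>\<not> Tc \<le> B\<close> by (auto simp: b_def)
      have Lnn: "0 \<le> L s" if "0 \<le> s" for s
        using L that by (force simp: positive_log_rate_le_def)
      have y0: "(\<lambda>_. 0) \<in> admissible_signals L t0"
        "t0 \<le> t \<Longrightarrow> time_deriv t0 (time_deriv t0 (\<lambda>_. 0)) t = 0" for t
        by (rule zero_signal_admissible(1), rule Lnn, assumption)
          (rule zero_signal_admissible(2)[of L], rule Lnn)
      obtain C where C: "0 \<le> C" "\<And>t x v. t \<in> {t0..t0 + b} \<Longrightarrow>
          v \<in> filippov_set (pt_error_system g alpha Tc L M LL MM t0 (\<lambda>_. 0) t) x \<Longrightarrow> norm v \<le> C * (1 + norm x)"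
        by (rule pt_error_system_linear_growth[OF Tc alpha b(1,2) L bspec[OF scale] y0(2)]) blast+
      \<comment> \<open>A zero of the solution at some \<open>t\<close> would give
        \<open>1 + (norm (e t0))\<^sup>2 \<le> R\<close> by the Gronwall estimate. As
        \<open>R \<ge> 1\<close>, also \<open>R \<le> R\<^sup>2\<close>, so an initial norm above
        \<open>R\<close> is contradictory.\<close>
      define R where "R = exp (3 * C * b)"
      obtain e where e: "filippov_solution (pt_error_system g alpha Tc L M LL MM t0 (\<lambda>_. 0)) t0 e" "R < norm (e t0)"
        using forward_complete_large_solution[OF fc y0(1)] .
      have "e t \<noteq> 0" if t: "t \<in> {t0..t0 + b}" for t
      proof
        assume "e t = 0"
        have "1 + (norm (e t0))\<^sup>2 \<le> (1 + (norm (e t))\<^sup>2) * exp (3 * C * (t - t0))"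
          using t by (intro filippov_solution_lower_bound[OF e(1) C(1) C(2)]) auto
        also have "\<dots> \<le> R"
          using t C(1) \<open>e t = 0\<close> by (auto simp: R_def intro!: mult_left_mono)
        also have "\<dots> \<le> R\<^sup>2"
          using C(1) b by (simp add: R_def power2_eq_square)
        also have "\<dots> < (norm (e t0))\<^sup>2"
          using e(2) by (intro power_strict_mono) (auto simp: R_def)
        finally show False by simp
      qed
      from settling_time_ge[of "\<lambda>_. 0" "admissible_signals L" t0
          "pt_error_system g alpha Tc L M LL MM" e "e t0" b, OF y0(1) e(1) refl this]
      have "ereal b \<le> ereal B"
        using B t0 unfolding is_UBST_def by (meson order_trans)
      with b show False by simp
    qed
  qed
qed

end
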